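(* Let $\kappa\ge 0$ and let $f:\mathbb{R}\to\mathbb{R}$. For $1\le\ell\le n$, define $F(x_1,x_2,\ldots,x_n)=f(x_\ell)$. Then the intertwining operator $V_\kappa$ of type $A_{n-1}$ acting on $F$ is given by $$V_\kappa F(x)=c_\kappa^{(n)}\int_{T^{n-1}}f(x_1t_1+x_2t_2+\cdots+x_nt_n)\,t_\ell\prod_{j=1}^n t_j^{\kappa-1}\,dt_1dt_2\cdots dt_{n-1},$$ where $t_n=1-\sum_{j=1}^{n-1}t_j$ and $c_\kappa^{(n)}=nc_\kappa=\Gamma(n\kappa+1)/\big(\kappa\,\Gamma(\kappa)^n\big)$, with $c_\kappa=\Gamma(n\kappa)/\Gamma(\kappa)^n$.
   Context: Dunkl operators (symmetric group $S_n$, root system $A_{n-1}$): for a nonnegative real number $\kappa$ and $1\le i\le n$, acting on functions on $\mathbb{R}^n$, $$D_i f(x)=\frac{\partial f}{\partial x_i}(x)+\kappa\sum_{j\ne i}\frac{f(x)-f(x(i,j))}{x_i-x_j},$$ where $x(i,j)$ is $x$ with its $i$th and $j$th coordinates exchanged. Intertwining operator: let $\mathcal{P}_m^n$ be the space of homogeneous polynomials of degree $m$ in $n$ variables. $V_\kappa$ is the unique linear operator with $V_\kappa:\mathcal{P}_m^n\to\mathcal{P}_m^n$ for all $m$, $V_\kappa 1=1$, and $D_iV_\kappa=V_\kappa\partial_i$ for $1\le i\le n$. It is known that $V_\kappa$ can be expressed as an integral operator: for each $x$ there is a nonnegative probability measure $d\mu_x$ with $V_\kappa g(x)=\int_{\mathbb{R}^n}g(y)\,d\mu_x(y)$;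 this gives the action of $V_\kappa$ on non-polynomial functions. Simplex: $T^{n-1}=\{(t_1,\ldots,t_{n-1}):t_j>0,\ \sum_{j=1}^{n-1}t_j<1\}\subset\mathbb{R}^{n-1}$.
   Formalization: At κ=0 the constant and integral are undefined (Γ(0), divergence), so the formula is read as the limit κ→0+ for continuous f, with V_0F(x)=f(x_ℓ) for Borel f; f is taken Borel measurable so that V_κF, as an integral against μ_x, makes sense. *)

theory Defs
  imports "HOL-Probability.Probability"
begin

text \<open>The index set of the coordinates is a finite type \<open>'n\<close>, so that the dimension is
  \<open>n = CARD('n) \<ge> 1\<close> and points of n-space are vectors of type \<open>real^'n\<close>.\<close>

definition swap_coords :: "'n \<Rightarrow> 'n \<Rightarrow> real^'n \<Rightarrow> real^'n" where
  "swap_coords i j x = (\<chi> m. x $ Transposition.transpose i j m)"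

definition partial_deriv :: "'n::finite \<Rightarrow> (real^'n \<Rightarrow> real) \<Rightarrow> real^'n \<Rightarrow> real" where
  "partial_deriv i f x = deriv (\<lambda>s. f (x + s *\<^sub>R axis i 1)) 0"

text \<open>On the hyperplane \<open>x $ i = x $ j\<close> the difference quotient of the Dunkl operator reads
  0/0 and is meant as its continuous extension, which exists for every polynomial.  (The
  convention a/0 = 0 would give a discontinuous, wrong value there.)\<close>

definition dunkl_quotient :: "'n::finite \<Rightarrow> 'n \<Rightarrow> (real^'n \<Rightarrow> real) \<Rightarrow> real^'n \<Rightarrow> real" where
  "dunkl_quotient i j f x =
     (if x $ i \<noteq> x $ j then (f x - f (swap_coords i j x)) / (x $ i - x $ j)
      else Lim (at x within {y. y $ i \<noteq> y $ j})
             (\<lambda>y. (f y - f (swap_coords i j y)) / (y $ i - y $ j)))"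

definition dunkl :: "real \<Rightarrow> 'n::finite \<Rightarrow> (real^'n \<Rightarrow> real) \<Rightarrow> real^'n \<Rightarrow> real" where
  "dunkl \<kappa> i f x = partial_deriv i f x + \<kappa> * (\<Sum>j\<in>UNIV - {i}. dunkl_quotient i j f x)"

text \<open>Homogeneous polynomials of degree m; \<open>a i\<close> is the exponent of the i-th variable, and the
  set of exponents summed over is finite.\<close>

definition homogeneous_polys :: "nat \<Rightarrow> (real^'n::finite \<Rightarrow> real) set" where
  "homogeneous_polys m =
     {p. \<exists>c. p = (\<lambda>x. \<Sum>a | (\<Sum>i\<in>UNIV. a i) = m. c a * (\<Prod>i\<in>UNIV. (x $ i) ^ a i))}"

lemma finite_exponents: "finite {a :: 'n::finite \<Rightarrow> nat. (\<Sum>i\<in>UNIV. a i) = m}"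
proof (rule finite_subset)
  show "{a :: 'n \<Rightarrow> nat. (\<Sum>i\<in>UNIV. a i) = m} \<subseteq> PiE UNIV (\<lambda>_. {..m})"
    by (auto simp: PiE_def intro: member_le_sum)
  show "finite (PiE (UNIV :: 'n set) (\<lambda>_. {..m}))"
    by (rule finite_PiE) auto
qed

text \<open>The characterising properties of the intertwining operator.  It acts on polynomials, so
  nothing is required of its values at other functions.\<close>

definition dunkl_intertwining ::
  "real \<Rightarrow> ((real^'n::finite \<Rightarrow> real) \<Rightarrow> real^'n \<Rightarrow> real) \<Rightarrow> bool" where
  "dunkl_intertwining \<kappa> V \<longleftrightarrow>
     (\<forall>p q a b. real_polynomial_function p \<longrightarrow> real_polynomial_function q \<longrightarrow>
        V (\<lambda>x. a * p x + b * q x) = (\<lambda>x. a * V p x + b * V q x)) \<and>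
     (\<forall>m. \<forall>p \<in> homogeneous_polys m. V p \<in> homogeneous_polys m) \<and>
     V (\<lambda>x. 1) = (\<lambda>x. 1) \<and>
     (\<forall>i p. real_polynomial_function p \<longrightarrow> dunkl \<kappa> i (V p) = V (partial_deriv i p))"

text \<open>M is a probability measure \<open>d\<mu>\<^sub>x\<close> representing V at the point x; the action of V on a
  non-polynomial function g is then by definition \<open>V g x = \<integral>y. g y \<partial>M\<close>.\<close>

definition represents_at ::
  "((real^'n::finite \<Rightarrow> real) \<Rightarrow> real^'n \<Rightarrow> real) \<Rightarrow> real^'n \<Rightarrow> (real^'n) measure \<Rightarrow> bool" where
  "represents_at V x M \<longleftrightarrow>
     prob_space M \<and> sets M = sets borel \<and>
     (\<forall>g. real_polynomial_function g \<longrightarrow> integrable M g \<and> V g x = (\<integral>y. g y \<partial>M))"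

text \<open>The simplex of dimension n - 1.  Its coordinates are indexed by all indices except one
  index k, the one of the dependent coordinate; with the indices 1,...,n one takes k = n.  For
  n = 1 the product measure over the empty index set is the unit mass at a point.\<close>

definition open_simplex :: "'n::finite \<Rightarrow> ('n \<Rightarrow> real) set" where
  "open_simplex k = {t \<in> PiE (UNIV - {k}) (\<lambda>_. UNIV).
                 (\<forall>j\<in>UNIV - {k}. 0 < t j) \<and> (\<Sum>j\<in>UNIV - {k}. t j) < 1}"

definition simplex_measure :: "'n::finite \<Rightarrow> ('n \<Rightarrow> real) measure" where
  "simplex_measure k = PiM (UNIV - {k}) (\<lambda>_. lborel)"

definition full_coords :: "'n::finite \<Rightarrow> ('n \<Rightarrow> real) \<Rightarrow> 'n \<Rightarrow> real" where
  "full_coords k t = t(k := 1 - (\<Sum>j\<in>UNIV - {k}. t j))"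

definition simplex_integrand ::
  "real \<Rightarrow> 'n::finite \<Rightarrow> 'n \<Rightarrow> (real \<Rightarrow> real) \<Rightarrow> real^'n \<Rightarrow> ('n \<Rightarrow> real) \<Rightarrow> real" where
  "simplex_integrand \<kappa> k l f x t =
     (let s = full_coords k t in
      f (\<Sum>j\<in>UNIV. x $ j * s j) * s l * (\<Prod>j\<in>UNIV. s j powr (\<kappa> - 1)))"

definition dirichlet_const :: "real \<Rightarrow> nat \<Rightarrow> real" where
  "dirichlet_const \<kappa> n = Gamma (real n * \<kappa>) / Gamma \<kappa> ^ n"

text \<open>The right-hand side, for \<open>\<kappa> > 0\<close>.  At \<open>\<kappa> = 0\<close> the constant and the integral have no meaning and
  the formula is to be read as the limit \<open>\<kappa> \<rightarrow> 0+\<close>: the normalised weight degenerates to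
  the unit mass at the vertex with index l.\<close>

definition simplex_formula ::
  "real \<Rightarrow> 'n::finite \<Rightarrow> 'n \<Rightarrow> (real \<Rightarrow> real) \<Rightarrow> real^'n \<Rightarrow> real" where
  "simplex_formula \<kappa> k l f x = (real CARD('n) * dirichlet_const \<kappa> CARD('n)) *
     (LINT t:open_simplex k|simplex_measure k. simplex_integrand \<kappa> k l f x t)"

end

theory Submission
  imports Defs
begin

text \<open>
  Let \<open>p\<^sub>m = V (y\<^sub>l\<^sup>m)\<close>.  This polynomial is homogeneous of degree m and satisfies
  \<open>D\<^sub>i p\<^sub>m = V (\<partial>\<^sub>i y\<^sub>l\<^sup>m)\<close>, which is \<open>m p\<^sub>m\<^sub>-\<^sub>1\<close> for \<open>i = l\<close> and 0 otherwise.  Multiplying by \<open>x\<^sub>i\<close> and summing over i, the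
  Euler identity for Dunkl operators (lemma \<open>euler_dunkl\<close>) gives, where the coordinates of x are distinct,

  \<open>m p\<^sub>m(x) + \<kappa> (\<Sum> i < j. p\<^sub>m(x) - p\<^sub>m(x(i,j))) = m x\<^sub>l p\<^sub>m\<^sub>-\<^sub>1(x).\<close>

  For \<open>m > 0\<close> this equation has at most one solution \<open>p\<^sub>m\<close>: the maximum principle on the finite orbit of x under the
  symmetric group forces a solution of the homogeneous equation to vanish (lemma \<open>swap_equation_unique\<close>).
  Points with distinct coordinates are dense, so the polynomials \<open>p\<^sub>m\<close> are determined by \<open>p\<^sub>0 = 1\<close> and these equations.

  For \<open>\<kappa> > 0\<close> the integral over the simplex with \<open>f(u) = u\<^sup>m\<close> is the moment of order m of \<open>x\<^sub>1 t\<^sub>1 + \<dots> + x\<^sub>n t\<^sub>n\<close> under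
  the Dirichlet distribution with parameter \<open>\<kappa> + 1\<close> at l and \<open>\<kappa>\<close> at the other indices.  By Dirichlet's integral
  (lemma \<open>nn_integral_dirichlet\<close>) these moments satisfy a contiguity relation (lemma \<open>dirichlet_moment_recurrence\<close>),
  and together with the symmetry of the moments under permutations it is the equation above.  This proves the
  formula for polynomials.  A representing measure at x has image under the l-th coordinate with the same moments
  as the law of \<open>x\<^sub>1 t\<^sub>1 + \<dots> + x\<^sub>n t\<^sub>n\<close>, which has bounded support, so both laws coincide (lemma
  \<open>real_distribution_eqI_moments\<close>), and the formula follows for all measurable f.

  For \<open>\<kappa> = 0\<close> the equation gives \<open>p\<^sub>m(x) = x\<^sub>l\<^sup>m\<close>, so under a representing measure the l-th coordinate has variance 0
  and equals \<open>x\<^sub>l\<close> almost surely.  The Dirichlet distributions with parameters \<open>\<epsilon> + 1\<close> at l and \<open>\<epsilon>\<close> elsewhere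
  concentrate at the vertex with index l as \<open>\<epsilon> \<rightarrow> 0\<close>, because the mean of the l-th coordinate tends to 1.
\<close>

section \<open>Dirichlet integrals\<close>

lemma nn_integral_beta:
  fixes a b :: real
  assumes "0 < a" "0 < b"
  shows "(\<integral>\<^sup>+t. ennreal (if 0 < t \<and> t < 1 then t powr (a - 1) * (1 - t) powr (b - 1) else 0) \<partial>lborel)
    = ennreal (Beta a b)"
proof (rule nn_integral_has_integral_lborel)
  have "((\<lambda>t. t powr (a - 1) * (1 - t) powr (b - 1)) has_integral Beta a b) {0<..<1}"
    using has_integral_Beta_real[OF assms] by (simp add: has_integral_Icc_iff_Ioo)
  then show "((\<lambda>t. if 0 < t \<and> t < 1 then t powr (a - 1) * (1 - t) powr (b - 1) else 0)
      has_integral Beta a b) UNIV"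
    by (subst (asm) has_integral_restrict_UNIV [symmetric]) (simp add: greaterThanLessThan_iff)
qed auto

lemma nn_integral_beta_scaled:
  fixes a b r :: real
  assumes ab: "0 < a" "0 < b" and "0 < r"
  shows "(\<integral>\<^sup>+t. ennreal (if 0 < t \<and> t < r then t powr (a - 1) * (r - t) powr (b - 1) else 0) \<partial>lborel)
    = ennreal (r powr (a + b - 1) * Beta a b)"
    (is "(\<integral>\<^sup>+t. ennreal (?f t) \<partial>lborel) = _")
proof -
  let ?g = "\<lambda>t. if 0 < t \<and> t < 1 then t powr (a - 1) * (1 - t) powr (b - 1) else 0"
  have scale: "?f (0 + r * t) = r powr (a + b - 2) * ?g t" for t
  proof (cases "0 < t \<and> t < 1")
    case True
    then have "(r * t) powr (a - 1) * (r * (1 - t)) powr (b - 1)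
        = (r powr (a - 1) * r powr (b - 1)) * (t powr (a - 1) * (1 - t) powr (b - 1))"
      using \<open>0 < r\<close> by (simp add: powr_mult)
    moreover have "r powr (a - 1) * r powr (b - 1) = r powr (a + b - 2)"
      by (simp flip: powr_add)
    ultimately show ?thesis
      using True \<open>0 < r\<close> by (simp add: algebra_simps)
  next
    case False
    then show ?thesis
      using \<open>0 < r\<close> by (auto simp: zero_less_mult_iff)
  qed
  have "(\<integral>\<^sup>+t. ennreal (?f t) \<partial>lborel) = ennreal \<bar>r\<bar> * (\<integral>\<^sup>+t. ennreal (?f (0 + r * t)) \<partial>lborel)"
    using \<open>0 < r\<close> by (intro nn_integral_real_affine) auto
  also have "\<dots> = ennreal r * (\<integral>\<^sup>+t. ennreal (r powr (a + b - 2)) * ennreal (?g t) \<partial>lborel)"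
    using \<open>0 < r\<close> by (subst scale, subst ennreal_mult) auto
  also have "\<dots> = ennreal r * (ennreal (r powr (a + b - 2)) * ennreal (Beta a b))"
    by (subst nn_integral_cmult) (auto simp: nn_integral_beta[OF ab])
  also have "\<dots> = ennreal (r * (r powr (a + b - 2) * Beta a b))"
    using \<open>0 < r\<close> by (simp add: ennreal_mult' ennreal_mult'')
  also have "r * (r powr (a + b - 2) * Beta a b) = r powr (a + b - 1) * Beta a b"
    using \<open>0 < r\<close> powr_mult_base[of r "a + b - 2"] by (simp add: algebra_simps)
  finally show ?thesis .
qed

text \<open>The Dirichlet density on the simplex \<open>{t. t j > 0, sum t I < r}\<close> of size r: the exponent \<open>b - 1\<close> belongs to the
  slack \<open>r - sum t I\<close>.  The size r is kept variable because fixing one coordinate t of a point of the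
  simplex of size r leaves a simplex of size \<open>r - t\<close>.\<close>

definition dirichlet_integrand ::
    "'i set \<Rightarrow> ('i \<Rightarrow> real) \<Rightarrow> real \<Rightarrow> real \<Rightarrow> ('i \<Rightarrow> real) \<Rightarrow> real" where
  "dirichlet_integrand I a b r t =
     (if (\<forall>j\<in>I. 0 < t j) \<and> sum t I < r
      then (\<Prod>j\<in>I. t j powr (a j - 1)) * (r - sum t I) powr (b - 1) else 0)"

lemma borel_measurable_dirichlet_integrand [measurable]:
  assumes "finite I"
  shows "dirichlet_integrand I a b r \<in> borel_measurable (PiM I (\<lambda>_. lborel))"
proof -
  have [measurable]: "(\<lambda>t. t j) \<in> borel_measurable (PiM I (\<lambda>_. lborel))" if "j \<in> I" for j
    using measurable_component_singleton[OF that, of "\<lambda>_. lborel"] by simp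
  show ?thesis
    unfolding dirichlet_integrand_def using assms by measurable
qed

text \<open>Dirichlet's integral.  Integrating out one coordinate at a time, the induction hypothesis contributes a
  power of the remaining size \<open>r - s\<close>, and the integral over s is a Beta integral.\<close>

lemma nn_integral_dirichlet:
  fixes a :: "'i \<Rightarrow> real"
  assumes "finite I" and "\<And>j. j \<in> I \<Longrightarrow> 0 < a j" and b: "0 < b" and "0 < r"
  shows "(\<integral>\<^sup>+t. ennreal (dirichlet_integrand I a b r t) \<partial>PiM I (\<lambda>_. lborel))
    = ennreal (r powr (sum a I + b - 1) * ((\<Prod>j\<in>I. Gamma (a j)) * Gamma b / Gamma (sum a I + b)))"
  using assms(1,2,4)
proof (induction I arbitrary: r rule: finite_induct)
  case empty
  have "Gamma b \<noteq> 0"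
    using Gamma_real_pos[OF b] by simp
  interpret product_sigma_finite "\<lambda>_::'i. lborel :: real measure" ..
  show ?case
    using empty \<open>Gamma b \<noteq> 0\<close> by (simp add: dirichlet_integrand_def nn_integral_count_space_finite PiM_empty)
next
  case (insert i I)
  interpret product_sigma_finite "\<lambda>_::'i. lborel :: real measure" ..
  let ?G = "\<lambda>I. (\<Prod>j\<in>I. Gamma (a j)) * Gamma b / Gamma (sum a I + b)"
  have pos: "0 < a i" "\<And>j. j \<in> I \<Longrightarrow> 0 < a j"
    using insert.prems by auto
  have a_nonneg: "0 \<le> sum a I"
    using pos by (intro sum_nonneg) (auto intro: less_imp_le)
  have "0 \<le> ?G I"
    using pos b a_nonneg
    by (intro divide_nonneg_nonneg mult_nonneg_nonneg prod_nonneg)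
       (auto intro!: less_imp_le[OF Gamma_real_pos])
  have split: "dirichlet_integrand (insert i I) a b r (t(i := s))
      = (if 0 < s \<and> s < r then s powr (a i - 1) else 0) * dirichlet_integrand I a b (r - s) t" for s t
  proof -
    have upd: "(\<forall>j\<in>insert i I. 0 < (t(i := s)) j) \<longleftrightarrow> 0 < s \<and> (\<forall>j\<in>I. 0 < t j)"
      "sum (t(i := s)) (insert i I) = s + sum t I"
      "(\<Prod>j\<in>insert i I. (t(i := s)) j powr (a j - 1)) = s powr (a i - 1) * (\<Prod>j\<in>I. t j powr (a j - 1))"
      using insert.hyps by (auto intro!: sum.cong prod.cong)
    have "s < r" if "\<forall>j\<in>I. 0 < t j" "s + sum t I < r"
      proof -
      have "0 \<le> sum t I"
        using that by (intro sum_nonneg) (auto intro: less_imp_le)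
      then show ?thesis
        using that by linarith
    qed
    then show ?thesis
      unfolding dirichlet_integrand_def upd by (auto simp: algebra_simps)
  qed
  have "(\<integral>\<^sup>+t. ennreal (dirichlet_integrand (insert i I) a b r t) \<partial>PiM (insert i I) (\<lambda>_. lborel))
      = (\<integral>\<^sup>+s. \<integral>\<^sup>+t. ennreal (dirichlet_integrand (insert i I) a b r (t(i := s))) \<partial>PiM I (\<lambda>_. lborel) \<partial>lborel)"
    using insert.hyps by (subst product_nn_integral_insert_rev) auto
  also have "\<dots> = (\<integral>\<^sup>+s. ennreal (if 0 < s \<and> s < r then s powr (a i - 1) else 0) *
      (\<integral>\<^sup>+t. ennreal (dirichlet_integrand I a b (r - s) t) \<partial>PiM I (\<lambda>_. lborel)) \<partial>lborel)"
    using insert.hyps by (simp add: split ennreal_mult' nn_integral_cmult)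
  also have "\<dots> = (\<integral>\<^sup>+s. ennreal (?G I) *
      ennreal (if 0 < s \<and> s < r then s powr (a i - 1) * (r - s) powr (sum a I + b - 1) else 0) \<partial>lborel)"
    using insert.IH pos \<open>0 \<le> ?G I\<close>
    by (intro nn_integral_cong) (auto simp flip: ennreal_mult' ennreal_mult'' simp: mult_ac)
  also have "\<dots> = ennreal (?G I) * ennreal (r powr (a i + (sum a I + b) - 1) * Beta (a i) (sum a I + b))"
    using pos b a_nonneg insert.prems
    by (subst nn_integral_cmult) (auto simp: nn_integral_beta_scaled)
  also have "\<dots> = ennreal (?G I * (r powr (a i + (sum a I + b) - 1) * Beta (a i) (sum a I + b)))"
    using \<open>0 \<le> ?G I\<close> by (rule ennreal_mult' [symmetric])
  also have "?G I * (r powr (a i + (sum a I + b) - 1) * Beta (a i) (sum a I + b))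
      = r powr (sum a (insert i I) + b - 1) * ?G (insert i I)"
  proof -
    have "0 < Gamma (sum a I + b)"
      using b a_nonneg by (intro Gamma_real_pos) auto
    then show ?thesis
      using insert.hyps by (simp add: Beta_def add_ac)
  qed
  finally show ?case .
qed

section \<open>Moments of linear forms under Dirichlet densities\<close>

lemma Gamma_real_plus1: "Gamma (z + 1) = z * Gamma z" if "0 < z" for z :: real
  using that by (intro Gamma_plus1) (auto elim: nonpos_Ints_cases)

text \<open>Raise the parameter with index l by one.  Multiplying a Dirichlet density by the coordinate with index l
  has this effect on its parameters.\<close>

definition bump :: "'n \<Rightarrow> ('n \<Rightarrow> real) \<Rightarrow> 'n \<Rightarrow> real" where
  "bump l a = a(l := a l + 1)"

lemma bump_commute: "bump i (bump j a) = bump j (bump i a)"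
  by (auto simp: bump_def fun_eq_iff)

lemma bump_pos: "(\<And>j. 0 < a j) \<Longrightarrow> 0 < bump l a j"
  by (simp add: bump_def add_pos_pos)

lemma sum_bump: "(\<Sum>i\<in>UNIV. bump l a i) = (\<Sum>i\<in>UNIV. a i) + 1" for l :: "'n::finite"
proof -
  have "bump l a i = a i + (if i = l then 1 else 0)" for i
    by (simp add: bump_def)
  then show ?thesis
    by (simp add: sum.distrib)
qed

lemma sum_pos_UNIV: "0 < (\<Sum>i\<in>UNIV. a i)" if "\<And>j. 0 < a j" for a :: "'n::finite \<Rightarrow> real"
  using that by (intro sum_pos) auto

text \<open>The multivariate Beta function, the total mass of the unnormalised Dirichlet density with parameters a.\<close>

definition multi_beta :: "('n::finite \<Rightarrow> real) \<Rightarrow> real" where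
  "multi_beta a = (\<Prod>j\<in>UNIV. Gamma (a j)) / Gamma (\<Sum>j\<in>UNIV. a j)"

lemma multi_beta_pos: "0 < multi_beta a" if "\<And>j. 0 < a j"
  unfolding multi_beta_def using that sum_pos_UNIV[of a]
  by (auto intro!: divide_pos_pos prod_pos Gamma_real_pos)

text \<open>The moment of order m of the linear form \<open>x\<^sub>1 t\<^sub>1 + \<dots> + x\<^sub>n t\<^sub>n\<close> under the unnormalised Dirichlet density with
  positive parameters a, given by its value (lemma \<open>has_bochner_integral_simplex_point_power\<close>).  Expanding one factor of the power gives the recursion, so that identities between these
  moments are proved by induction on m for all parameters at once, without the multinomial theorem.\<close>

primrec dirichlet_moment :: "real^'n::finite \<Rightarrow> nat \<Rightarrow> ('n \<Rightarrow> real) \<Rightarrow> real" where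
  "dirichlet_moment x 0 a = multi_beta a"
| "dirichlet_moment x (Suc m) a = (\<Sum>j\<in>UNIV. x $ j * dirichlet_moment x m (bump j a))"

lemma multi_beta_bump:
  fixes a :: "'n::finite \<Rightarrow> real"
  assumes "\<And>j. 0 < a j"
  shows "(\<Sum>j\<in>UNIV. a j) * multi_beta (bump l a) = a l * multi_beta a"
proof -
  let ?A = "\<Sum>j\<in>UNIV. a j"
  have "(\<Prod>j\<in>UNIV. Gamma (bump l a j)) = (\<Prod>j\<in>UNIV. (if j = l then a l else 1) * Gamma (a j))"
    using assms[of l] by (intro prod.cong) (auto simp: bump_def Gamma_real_plus1)
  also have "\<dots> = a l * (\<Prod>j\<in>UNIV. Gamma (a j))"
    by (simp add: prod.distrib)
  finally have "(\<Prod>j\<in>UNIV. Gamma (bump l a j)) = a l * (\<Prod>j\<in>UNIV. Gamma (a j))" .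
  moreover have "0 < ?A"
    by (intro sum_pos_UNIV assms)
  moreover from this have "Gamma (?A + 1) = ?A * Gamma ?A" "0 < Gamma ?A"
    by (simp_all add: Gamma_real_plus1)
  ultimately show ?thesis
    by (simp add: multi_beta_def sum_bump)
qed

text \<open>The contiguity relation between Dirichlet moments that matches Euler's identity for Dunkl operators.
  The subtraction \<open>m - 1\<close> truncates at \<open>m = 0\<close>, where the right-hand side vanishes because of the factor m.\<close>

lemma dirichlet_moment_recurrence:
  fixes a :: "'n::finite \<Rightarrow> real"
  assumes "\<And>j. 0 < a j"
  shows "(real m + (\<Sum>j\<in>UNIV. a j)) * dirichlet_moment x m (bump l a) - a l * dirichlet_moment x m a
    = real m * x $ l * dirichlet_moment x (m - 1) (bump l a)"
  using assms
proof (induction m arbitrary: a)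
  case 0
  then show ?case
    using multi_beta_bump[of a l] by simp
next
  case (Suc m)
  let ?J = "dirichlet_moment x" and ?A = "\<Sum>j\<in>UNIV. a j"
  have IH: "(real m + ?A + 1) * ?J m (bump l (bump j a)) - bump j a l * ?J m (bump j a)
      = real m * x $ l * ?J (m - 1) (bump l (bump j a))" for j
    using Suc.IH[of "bump j a", OF bump_pos, OF Suc.prems] by (simp add: sum_bump algebra_simps)
  have lower: "real m * (\<Sum>j\<in>UNIV. x $ j * ?J (m - 1) (bump l (bump j a))) = real m * ?J m (bump l a)"
    by (cases m) (simp_all add: bump_commute[of l])
  have delta: "(\<Sum>j\<in>UNIV. x $ j * ((bump j a l - a l) * ?J m (bump j a))) = x $ l * ?J m (bump l a)"
  proof -
    have "x $ j * ((bump j a l - a l) * ?J m (bump j a)) = (if j = l then x $ l * ?J m (bump l a) else 0)" for j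
      by (simp add: bump_def)
    then show ?thesis
      by simp
  qed
  have step: "?J (Suc m) (bump l a) = (\<Sum>j\<in>UNIV. x $ j * ?J m (bump l (bump j a)))"
    unfolding dirichlet_moment.simps by (rule sum.cong [OF refl]) (subst bump_commute, rule refl)
  have "(real (Suc m) + ?A) * ?J (Suc m) (bump l a) - a l * ?J (Suc m) a
      = (\<Sum>j\<in>UNIV. (real (Suc m) + ?A) * (x $ j * ?J m (bump l (bump j a)))
          - a l * (x $ j * ?J m (bump j a)))"
    unfolding step by (simp only: dirichlet_moment.simps sum_distrib_left sum_subtractf)
  also have "\<dots> = (\<Sum>j\<in>UNIV. x $ j * ((real m + ?A + 1) * ?J m (bump l (bump j a)) - bump j a l * ?J m (bump j a)))
        + (\<Sum>j\<in>UNIV. x $ j * ((bump j a l - a l) * ?J m (bump j a)))"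
    unfolding sum.distrib [symmetric] by (intro sum.cong refl) (simp add: algebra_simps)
  also have "\<dots> = x $ l * (real m * (\<Sum>j\<in>UNIV. x $ j * ?J (m - 1) (bump l (bump j a))))
        + x $ l * ?J m (bump l a)"
    unfolding IH delta by (simp add: sum_distrib_left mult_ac)
  also have "\<dots> = real (Suc m) * x $ l * ?J (Suc m - 1) (bump l a)"
    unfolding lower by (simp add: algebra_simps)
  finally show ?case .
qed

lemma sum_dirichlet_moment_bump:
  fixes a :: "'n::finite \<Rightarrow> real"
  assumes "\<And>j. 0 < a j"
  shows "(\<Sum>l\<in>UNIV. dirichlet_moment x m (bump l a)) = dirichlet_moment x m a"
  using assms
proof (induction m arbitrary: a)
  case 0
  let ?A = "\<Sum>j\<in>UNIV. a j"
  have "?A * (\<Sum>l\<in>UNIV. multi_beta (bump l a)) = ?A * multi_beta a"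
    using multi_beta_bump[of a, OF 0] by (simp only: sum_distrib_left sum_distrib_right)
  then show ?case
    using sum_pos_UNIV[of a] 0 by simp
next
  case (Suc m)
  have "(\<Sum>l\<in>UNIV. dirichlet_moment x (Suc m) (bump l a))
      = (\<Sum>j\<in>UNIV. x $ j * (\<Sum>l\<in>UNIV. dirichlet_moment x m (bump l (bump j a))))"
    unfolding dirichlet_moment.simps sum_distrib_left
    by (subst sum.swap) (intro sum.cong refl, subst bump_commute, rule refl)
  then show ?case
    using Suc.IH[of "bump j a" for j, OF bump_pos, OF Suc.prems] by simp
qed

lemma dirichlet_moment_permute:
  fixes a :: "'n::finite \<Rightarrow> real"
  assumes "\<pi> permutes UNIV"
  shows "dirichlet_moment (\<chi> i. x $ \<pi> i) m (a \<circ> \<pi>) = dirichlet_moment x m a"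
proof (induction m arbitrary: a)
  case 0
  show ?case
    using prod.permute[OF assms, of "\<lambda>j. Gamma (a j)"] sum.permute[OF assms, of a]
    by (simp add: multi_beta_def comp_def)
next
  case (Suc m)
  have "bump j (a \<circ> \<pi>) = bump (\<pi> j) a \<circ> \<pi>" for j
    using permutes_inj[OF assms] by (auto simp: bump_def fun_eq_iff inj_eq)
  then show ?case
    using sum.permute[OF assms, of "\<lambda>j. x $ j * dirichlet_moment x m (bump j a)"] Suc.IH
    by (simp add: comp_def)
qed

lemma continuous_on_dirichlet_moment: "continuous_on S (\<lambda>x. dirichlet_moment x m a)"
  by (induction m arbitrary: a) (auto intro!: continuous_intros)

section \<open>The Euler identity for Dunkl operators and a maximum principle\<close>

lemma swap_coords_same [simp]: "swap_coords i i x = x"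
  by (simp add: swap_coords_def vec_eq_iff)

lemma swap_coords_commute: "swap_coords i j = swap_coords j i"
  by (simp add: swap_coords_def fun_eq_iff transpose_commute)

lemma homogeneous_polys_polynomial:
  "p \<in> homogeneous_polys m \<Longrightarrow> real_polynomial_function p"
proof -
  assume "p \<in> homogeneous_polys m"
  then obtain c where p: "p = (\<lambda>x. \<Sum>a | (\<Sum>i\<in>UNIV. a i) = m. c a * (\<Prod>i\<in>UNIV. (x $ i) ^ a i))"
    by (auto simp: homogeneous_polys_def)
  have coord: "real_polynomial_function (\<lambda>x :: real^'a. x $ i)" for i
    by (intro real_polynomial_function.intros(1) bounded_linear_vec_nth)
  show ?thesis
    unfolding p
    by (intro real_polynomial_function_sum finite_exponents real_polynomial_function.intros(4)
        real_polynomial_function.intros(2) real_polynomial_function_prod finite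
        real_polynomial_function_power coord)
qed

lemma homogeneous_polys_scale:
  assumes "p \<in> homogeneous_polys m"
  shows "p (r *\<^sub>R x) = r ^ m * p x"
proof -
  obtain c where p: "p = (\<lambda>x. \<Sum>a | (\<Sum>i\<in>UNIV. a i) = m. c a * (\<Prod>i\<in>UNIV. (x $ i) ^ a i))"
    using assms by (auto simp: homogeneous_polys_def)
  have "(\<Prod>i\<in>UNIV. ((r *\<^sub>R x) $ i) ^ a i) = r ^ m * (\<Prod>i\<in>UNIV. (x $ i) ^ a i)"
    if "(\<Sum>i\<in>UNIV. a i) = m" for a :: "'a \<Rightarrow> nat"
    using that by (simp add: power_mult_distrib prod.distrib flip: power_sum)
  then show ?thesis
    unfolding p by (simp add: sum_distrib_left algebra_simps)
qed

lemma euler_homogeneous: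
  fixes x :: "real^'n::finite"
  assumes "p \<in> homogeneous_polys m"
  shows "(\<Sum>i\<in>UNIV. x $ i * partial_deriv i p x) = real m * p x"
proof -
  obtain p' where p': "(p has_derivative p') (at x)"
    using differentiable_at_real_polynomial_function[OF homogeneous_polys_polynomial[OF assms], of x UNIV]
    by (auto simp: differentiable_def)
  then interpret p': bounded_linear p'
    by (rule has_derivative_bounded_linear)
  have line: "((\<lambda>s. p (x + s *\<^sub>R v)) has_real_derivative p' v) (at 0)" for v
  proof -
    have "((\<lambda>s. x + s *\<^sub>R v) has_derivative (\<lambda>s. s *\<^sub>R v)) (at (0::real))"
      by (auto intro!: derivative_eq_intros)
    then have "((\<lambda>s. p (x + s *\<^sub>R v)) has_derivative (\<lambda>s. p' (s *\<^sub>R v))) (at (0::real))"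
      using p' has_derivative_compose[of "\<lambda>s. x + s *\<^sub>R v" _ 0 UNIV p p'] by simp
    then show ?thesis
      by (simp add: has_field_derivative_def p'.scaleR mult.commute[of _ "p' v"])
  qed
  have "x = (\<Sum>i\<in>UNIV. x $ i *\<^sub>R axis i 1)"
    by (simp add: vec_eq_iff axis_def if_distrib cong: if_cong)
  then have "p' x = p' (\<Sum>i\<in>UNIV. x $ i *\<^sub>R axis i 1)"
    by (rule arg_cong)
  also have "\<dots> = (\<Sum>i\<in>UNIV. x $ i * p' (axis i 1))"
    by (simp add: p'.sum p'.scaleR)
  also have "\<dots> = (\<Sum>i\<in>UNIV. x $ i * partial_deriv i p x)"
    by (simp add: partial_deriv_def DERIV_imp_deriv[OF line])
  finally have "p' x = (\<Sum>i\<in>UNIV. x $ i * partial_deriv i p x)" .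
  moreover have "p' x = real m * p x"
  proof (rule DERIV_unique[OF line])
    have "x + s *\<^sub>R x = (1 + s) *\<^sub>R x" for s
      by (simp add: algebra_simps)
    then have "(\<lambda>s. p (x + s *\<^sub>R x)) = (\<lambda>s. (1 + s) ^ m * p x)"
      using homogeneous_polys_scale[OF assms] by simp
    then show "((\<lambda>s. p (x + s *\<^sub>R x)) has_real_derivative real m * p x) (at 0)"
      by (auto intro!: derivative_eq_intros)
  qed
  ultimately show ?thesis by simp
qed

text \<open>For a point with pairwise distinct coordinates, Euler's identity for Dunkl operators.  The difference
  quotients are antisymmetric in i and j, which turns the weights \<open>x $ i\<close> into \<open>(x $ i - x $ j) / 2\<close> and cancels
  the denominators.  Every transposition occurs twice in the double sum, hence the factor \<open>\<kappa> / 2\<close>.\<close>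

lemma euler_dunkl:
  fixes x :: "real^'n::finite"
  assumes p: "p \<in> homogeneous_polys m" and x: "inj (($) x)"
  shows "(\<Sum>i\<in>UNIV. x $ i * dunkl \<kappa> i p x)
    = real m * p x + \<kappa> / 2 * (\<Sum>i\<in>UNIV. \<Sum>j\<in>UNIV. p x - p (swap_coords i j x))"
proof -
  let ?Q = "\<lambda>i j. (p x - p (swap_coords i j x)) / (x $ i - x $ j)"
  have Q: "(\<Sum>j\<in>UNIV - {i}. dunkl_quotient i j p x) = (\<Sum>j\<in>UNIV. ?Q i j)" for i
  proof -
    have "(\<Sum>j\<in>UNIV - {i}. dunkl_quotient i j p x) = (\<Sum>j\<in>UNIV - {i}. ?Q i j)"
      using x by (intro sum.cong) (auto simp: dunkl_quotient_def inj_eq)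
    also have "\<dots> = (\<Sum>j\<in>UNIV. ?Q i j)"
      by (intro sum.mono_neutral_left) auto
    finally show ?thesis .
  qed
  have antisym: "?Q j i = - ?Q i j" for i j
    by (simp add: swap_coords_commute[of j i] minus_divide_right)
  have "(\<Sum>i\<in>UNIV. \<Sum>j\<in>UNIV. x $ i * ?Q i j) = (\<Sum>i\<in>UNIV. \<Sum>j\<in>UNIV. x $ j * ?Q j i)"
    by (rule sum.swap)
  also have "\<dots> = - (\<Sum>i\<in>UNIV. \<Sum>j\<in>UNIV. x $ j * ?Q i j)"
    unfolding sum_negf [symmetric]
    by (intro sum.cong refl, subst antisym, rule mult_minus_right)
  finally have "2 * (\<Sum>i\<in>UNIV. \<Sum>j\<in>UNIV. x $ i * ?Q i j)
      = (\<Sum>i\<in>UNIV. \<Sum>j\<in>UNIV. x $ i * ?Q i j) - (\<Sum>i\<in>UNIV. \<Sum>j\<in>UNIV. x $ j * ?Q i j)"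
    by linarith
  also have "\<dots> = (\<Sum>i\<in>UNIV. \<Sum>j\<in>UNIV. (x $ i - x $ j) * ?Q i j)"
    by (simp only: sum_subtractf [symmetric] left_diff_distrib [symmetric])
  also have "\<dots> = (\<Sum>i\<in>UNIV. \<Sum>j\<in>UNIV. p x - p (swap_coords i j x))"
  proof (intro sum.cong refl)
    show "(x $ i - x $ j) * ?Q i j = p x - p (swap_coords i j x)" for i j
      using x by (cases "i = j") (auto simp: inj_eq)
  qed
  finally have "(\<Sum>i\<in>UNIV. \<Sum>j\<in>UNIV. x $ i * ?Q i j)
      = 1 / 2 * (\<Sum>i\<in>UNIV. \<Sum>j\<in>UNIV. p x - p (swap_coords i j x))"
    by simp
  moreover have "(\<Sum>i\<in>UNIV. x $ i * dunkl \<kappa> i p x)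
      = (\<Sum>i\<in>UNIV. x $ i * partial_deriv i p x) + \<kappa> * (\<Sum>i\<in>UNIV. \<Sum>j\<in>UNIV. x $ i * ?Q i j)"
    unfolding dunkl_def Q by (simp add: sum.distrib sum_distrib_left algebra_simps)
  ultimately show ?thesis
    using euler_homogeneous[OF p, of x] by simp
qed

text \<open>A maximum principle: at a maximum of d over S the double sum is nonnegative, so \<open>m * d\<close> cannot be positive
  there.\<close>

lemma swap_equation_max_principle:
  fixes d :: "real^'n::finite \<Rightarrow> real"
  assumes "finite S" and swap: "\<And>y i j. y \<in> S \<Longrightarrow> swap_coords i j y \<in> S"
    and "0 < m" "0 \<le> \<kappa>"
    and eq: "\<And>y. y \<in> S \<Longrightarrow> m * d y + \<kappa> * (\<Sum>i\<in>UNIV. \<Sum>j\<in>UNIV. d y - d (swap_coords i j y)) = 0"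
    and "y \<in> S"
  shows "d y \<le> 0"
proof -
  have "Max (d ` S) \<in> d ` S"
    using \<open>finite S\<close> \<open>y \<in> S\<close> by (intro Max_in) auto
  then obtain z where "z \<in> S" "d z = Max (d ` S)"
    by auto
  then have z: "z \<in> S" "\<And>w. w \<in> S \<Longrightarrow> d w \<le> d z"
    using \<open>finite S\<close> by auto
  have "0 \<le> (\<Sum>i\<in>UNIV. \<Sum>j\<in>UNIV. d z - d (swap_coords i j z))"
    using z swap by (intro sum_nonneg) auto
  then have "m * d z \<le> 0"
    using eq[OF z(1)] \<open>0 \<le> \<kappa>\<close> by (smt (verit) mult_nonneg_nonneg)
  then have "d z \<le> 0"
    using \<open>0 < m\<close> by (simp add: mult_le_0_iff)
  with z(2)[OF \<open>y \<in> S\<close>] show ?thesis by linarith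
qed

text \<open>The maximum principle applies to d and to -d on the orbit of x under the symmetric group, which consists of
  points with pairwise distinct coordinates.\<close>

lemma swap_equation_unique:
  fixes d :: "real^'n::finite \<Rightarrow> real"
  assumes "0 < m" "0 \<le> \<kappa>"
    and eq: "\<And>y. inj (($) y) \<Longrightarrow>
      m * d y + \<kappa> * (\<Sum>i\<in>UNIV. \<Sum>j\<in>UNIV. d y - d (swap_coords i j y)) = 0"
    and x: "inj (($) x)"
  shows "d x = 0"
proof -
  let ?S = "(\<lambda>\<pi>. (\<chi> i. x $ \<pi> i) :: real^'n) ` {\<pi>. \<pi> permutes UNIV}"
  have fin: "finite ?S"
    by (simp add: finite_permutations)
  have swap: "swap_coords i j y \<in> ?S" if y: "y \<in> ?S" for i j y
  proof -
    obtain \<pi> where "\<pi> permutes UNIV" "y = (\<chi> i. x $ \<pi> i)"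
      using y by auto
    then have "swap_coords i j y = (\<chi> m. x $ (\<pi> \<circ> Transposition.transpose i j) m)"
      "(\<pi> \<circ> Transposition.transpose i j) permutes UNIV"
      by (auto simp: swap_coords_def intro!: permutes_compose permutes_swap_id)
    then show ?thesis by blast
  qed
  have gen: "inj (($) y)" if "y \<in> ?S" for y
    using that x by (auto simp: inj_def dest: permutes_inj)
  have mem: "x \<in> ?S"
    by (auto simp: image_iff intro!: exI[of _ id] permutes_id)
  have "d x \<le> 0"
    using fin swap \<open>0 < m\<close> \<open>0 \<le> \<kappa>\<close> eq[OF gen] mem by (rule swap_equation_max_principle)
  moreover have "- d x \<le> 0"
  proof (rule swap_equation_max_principle[where d = "\<lambda>y. - d y", OF fin swap \<open>0 < m\<close> \<open>0 \<le> \<kappa>\<close> _ mem])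
    fix y assume "y \<in> ?S"
    have "(\<Sum>i\<in>UNIV. \<Sum>j\<in>UNIV. - d y - - d (swap_coords i j y))
        = - (\<Sum>i\<in>UNIV. \<Sum>j\<in>UNIV. d y - d (swap_coords i j y))"
      by (simp flip: sum_negf)
    then show "m * - d y + \<kappa> * (\<Sum>i\<in>UNIV. \<Sum>j\<in>UNIV. - d y - - d (swap_coords i j y)) = 0"
      using eq[OF gen[OF \<open>y \<in> ?S\<close>]] by simp
  qed
  ultimately show ?thesis by simp
qed

text \<open>The points with pairwise distinct coordinates are dense: along a line whose direction has pairwise distinct
  coordinates all but finitely many points are of this kind.\<close>

lemma eq_if_eq_generic:
  fixes f g :: "real^'n::finite \<Rightarrow> real"
  assumes f: "continuous_on UNIV f" and g: "continuous_on UNIV g"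
    and eq: "\<And>y. inj (($) y) \<Longrightarrow> f y = g y"
  shows "f x = g x"
proof -
  obtain e :: "'n \<Rightarrow> nat" where e: "inj e"
    using finite_imp_inj_to_nat_seg[of "UNIV :: 'n set"] by auto
  define v :: "real^'n" where "v = (\<chi> i. real (e i))"
  let ?bad = "(\<lambda>(i, j). (x $ j - x $ i) / (v $ i - v $ j)) ` UNIV"
  have inj: "inj (($) (x + s *\<^sub>R v))" if "s \<notin> ?bad" for s
  proof (rule injI, rule ccontr)
    fix i j assume ij: "(x + s *\<^sub>R v) $ i = (x + s *\<^sub>R v) $ j" "i \<noteq> j"
    then have "v $ i - v $ j \<noteq> 0"
      using e by (simp add: v_def inj_eq)
    then have "s = (x $ j - x $ i) / (v $ i - v $ j)"
      using ij(1) by (simp add: field_simps)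
    with that show False by auto
  qed
  define B where "B = ?bad - {0}"
  have "finite B" "0 \<notin> B"
    by (auto simp: B_def)
  then have "eventually (\<lambda>s. s \<notin> B) (at 0)"
    by (intro eventually_at_topological[THEN iffD2] exI[of _ "- B"])
       (auto simp: finite_imp_closed open_Compl)
  then have ev: "eventually (\<lambda>s. f (x + s *\<^sub>R v) - g (x + s *\<^sub>R v) = 0) (at 0)"
    using eventually_neq_at_within[of 0 0 UNIV]
    by eventually_elim (use eq inj in \<open>auto simp: B_def\<close>)
  have "continuous_on UNIV (\<lambda>s. f (x + s *\<^sub>R v) - g (x + s *\<^sub>R v))"
    by (intro continuous_on_diff continuous_on_compose2[OF f] continuous_on_compose2[OF g]
        continuous_intros) auto
  then have "((\<lambda>s. f (x + s *\<^sub>R v) - g (x + s *\<^sub>R v)) \<longlongrightarrow> f (x + 0 *\<^sub>R v) - g (x + 0 *\<^sub>R v)) (at 0)"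
    unfolding continuous_on_def by blast
  moreover have "((\<lambda>s. f (x + s *\<^sub>R v) - g (x + s *\<^sub>R v)) \<longlongrightarrow> 0) (at 0)"
    using ev by (rule tendsto_eventually)
  ultimately have "f (x + 0 *\<^sub>R v) - g (x + 0 *\<^sub>R v) = 0"
    by (intro tendsto_unique[OF trivial_limit_at])
  then show ?thesis by simp
qed

section \<open>The intertwining operator on powers of a coordinate\<close>

lemma power_coord_polynomial: "real_polynomial_function (\<lambda>y :: real^'n::finite. y $ l ^ m)"
  by (intro real_polynomial_function_power real_polynomial_function.intros(1) bounded_linear_vec_nth)

lemma power_coord_homogeneous: "(\<lambda>y :: real^'n::finite. y $ l ^ m) \<in> homogeneous_polys m"
proof -
  define e :: "'n \<Rightarrow> nat" where "e = (\<lambda>i. if i = l then m else 0)"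
  define c :: "('n \<Rightarrow> nat) \<Rightarrow> real" where "c = (\<lambda>a. if a = e then 1 else 0)"
  have "y $ l ^ m = (\<Sum>a | (\<Sum>i\<in>UNIV. a i) = m. c a * (\<Prod>i\<in>UNIV. (y $ i) ^ a i))" for y :: "real^'n"
  proof -
    have "(\<Sum>a | (\<Sum>i\<in>UNIV. a i) = m. c a * (\<Prod>i\<in>UNIV. (y $ i) ^ a i))
        = (\<Sum>a | (\<Sum>i\<in>UNIV. a i) = m. if a = e then (\<Prod>i\<in>UNIV. (y $ i) ^ e i) else 0)"
      by (intro sum.cong) (auto simp: c_def)
    also have "\<dots> = (\<Prod>i\<in>UNIV. (y $ i) ^ e i)"
      using finite_exponents[of m] by (subst sum.delta) (auto simp: e_def)
    also have "\<dots> = (\<Prod>i\<in>UNIV. if i = l then y $ l ^ m else 1)"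
      by (intro prod.cong) (auto simp: e_def)
    finally show ?thesis
      by simp
  qed
  then show ?thesis
    unfolding homogeneous_polys_def by blast
qed

lemma partial_deriv_power_coord:
  "partial_deriv i (\<lambda>y :: real^'n::finite. y $ l ^ Suc m) = (\<lambda>y. (if i = l then real (Suc m) else 0) * y $ l ^ m)"
proof
  fix x :: "real^'n"
  have "((\<lambda>s. (x $ l + s * axis i 1 $ l) ^ Suc m) has_real_derivative
      real (Suc m) * axis i 1 $ l * x $ l ^ m) (at 0)"
  proof -
    have "((\<lambda>s. x $ l + s * axis i 1 $ l) has_real_derivative axis i 1 $ l) (at 0)"
      by (auto intro!: derivative_eq_intros)
    from DERIV_power_Suc[OF this, of m] show ?thesis
      by (simp add: mult.assoc add.commute)
  qed
  then show "partial_deriv i (\<lambda>y. y $ l ^ Suc m) x = (if i = l then real (Suc m) else 0) * x $ l ^ m"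
    unfolding partial_deriv_def by (subst DERIV_imp_deriv) (auto simp: axis_def)
qed

lemma
  assumes "dunkl_intertwining \<kappa> V"
  shows intertwining_linear: "real_polynomial_function p \<Longrightarrow> real_polynomial_function q \<Longrightarrow>
      V (\<lambda>x. a * p x + b * q x) = (\<lambda>x. a * V p x + b * V q x)"
    and intertwining_homogeneous: "p \<in> homogeneous_polys m \<Longrightarrow> V p \<in> homogeneous_polys m"
    and intertwining_one: "V (\<lambda>x. 1) = (\<lambda>x. 1)"
    and intertwining_dunkl: "real_polynomial_function p \<Longrightarrow> dunkl \<kappa> i (V p) = V (partial_deriv i p)"
  using assms by (simp_all add: dunkl_intertwining_def)

text \<open>The equation that Euler's identity gives for \<open>V (\<lambda>y. y $ l ^ m)\<close> determines this polynomial from the one of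
  degree \<open>m - 1\<close>, so every continuous solution q of the recursion computes V.\<close>

lemma intertwining_power_coord:
  fixes V :: "(real^'n::finite \<Rightarrow> real) \<Rightarrow> real^'n \<Rightarrow> real"
  assumes "0 \<le> \<kappa>" and V: "dunkl_intertwining \<kappa> V"
    and q0: "\<And>x. q 0 x = 1"
    and q_cont: "\<And>m. continuous_on UNIV (q m)"
    and q_eq: "\<And>m x. real m * q m x + \<kappa> / 2 * (\<Sum>i\<in>UNIV. \<Sum>j\<in>UNIV. q m x - q m (swap_coords i j x))
      = real m * x $ l * q (m - 1) x"
  shows "V (\<lambda>y. y $ l ^ m) = q m"
proof (induction m)
  case 0
  show ?case
    using intertwining_one[OF V] q0 by (simp add: fun_eq_iff)
next
  case (Suc m)
  let ?u = "\<lambda>m (y :: real^'n). y $ l ^ m"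
  let ?p = "V (?u (Suc m))"
  have lin: "V (\<lambda>y. a * ?u m y + b * ?u m y) = (\<lambda>y. a * V (?u m) y + b * V (?u m) y)" for a b
    by (rule intertwining_linear[OF V power_coord_polynomial power_coord_polynomial])
  have p_hom: "?p \<in> homogeneous_polys (Suc m)"
    by (rule intertwining_homogeneous[OF V power_coord_homogeneous])
  have dunkl_p: "dunkl \<kappa> i ?p = (\<lambda>x. (if i = l then real (Suc m) else 0) * q m x)" for i
  proof -
    have "dunkl \<kappa> i ?p = V (partial_deriv i (?u (Suc m)))"
      by (rule intertwining_dunkl[OF V power_coord_polynomial])
    also have "\<dots> = (\<lambda>x. (if i = l then real (Suc m) else 0) * q m x)"
      unfolding partial_deriv_power_coord
      using lin[of "if i = l then real (Suc m) else 0" 0] Suc.IH by simp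
    finally show ?thesis .
  qed
  \<comment> \<open>Only \<open>i = l\<close> contributes, since the other partial derivatives of \<open>y $ l ^ Suc m\<close> vanish.\<close>
  have p_eq: "real (Suc m) * ?p x + \<kappa> / 2 * (\<Sum>i\<in>UNIV. \<Sum>j\<in>UNIV. ?p x - ?p (swap_coords i j x))
      = real (Suc m) * x $ l * q m x" if "inj (($) x)" for x
  proof -
    have "(\<Sum>i\<in>UNIV. x $ i * dunkl \<kappa> i ?p x)
        = (\<Sum>i\<in>UNIV. if i = l then x $ l * (real (Suc m) * q m x) else 0)"
      unfolding dunkl_p by (intro sum.cong) auto
    also have "\<dots> = real (Suc m) * x $ l * q m x"
      by simp
    finally show ?thesis
      using euler_dunkl[OF p_hom that, of \<kappa>] by simp
  qed
  have generic: "?p x = q (Suc m) x" if x: "inj (($) x)" for x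
  proof -
    have "?p x - q (Suc m) x = 0"
    proof (rule swap_equation_unique[where d = "\<lambda>y. ?p y - q (Suc m) y", OF _ _ _ x])
      show "real (Suc m) * (?p y - q (Suc m) y) + \<kappa> / 2 * (\<Sum>i\<in>UNIV. \<Sum>j\<in>UNIV.
          (?p y - q (Suc m) y) - (?p (swap_coords i j y) - q (Suc m) (swap_coords i j y))) = 0"
        if "inj (($) y)" for y
      proof -
        have split: "(\<Sum>i\<in>UNIV. \<Sum>j\<in>UNIV.
            (?p y - q (Suc m) y) - (?p (swap_coords i j y) - q (Suc m) (swap_coords i j y)))
          = (\<Sum>i\<in>UNIV. \<Sum>j\<in>UNIV. ?p y - ?p (swap_coords i j y))
            - (\<Sum>i\<in>UNIV. \<Sum>j\<in>UNIV. q (Suc m) y - q (Suc m) (swap_coords i j y))"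
          unfolding sum_subtractf [symmetric] by (intro sum.cong refl) simp
        show ?thesis
          unfolding split right_diff_distrib using p_eq[OF that] q_eq[of "Suc m" y]
          by (simp only: diff_Suc_1)
      qed
    qed (use \<open>0 \<le> \<kappa>\<close> in auto)
    then show ?thesis by simp
  qed
  have "continuous_on UNIV ?p"
    by (intro continuous_on_polymonial_function
        homogeneous_polys_polynomial[OF p_hom, unfolded real_polynomial_function_eq])
  then show ?case
    using eq_if_eq_generic[OF _ q_cont generic] by blast
qed

lemma sum_sum_transpose:
  fixes g :: "'n::finite \<Rightarrow> real"
  shows "(\<Sum>i\<in>UNIV. \<Sum>j\<in>UNIV. g l - g (Transposition.transpose i j l)) = 2 * (\<Sum>j\<in>UNIV. g l - g j)"
proof -
  have "g l - g (Transposition.transpose i j l) = (if i = l then g l - g j else 0) + (if j = l then g l - g i else 0)" for i j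
    by (auto simp: transpose_def)
  then have "(\<Sum>i\<in>UNIV. \<Sum>j\<in>UNIV. g l - g (Transposition.transpose i j l))
      = (\<Sum>i\<in>UNIV. \<Sum>j\<in>UNIV. if i = l then g l - g j else 0) + (\<Sum>i\<in>UNIV. \<Sum>j\<in>UNIV. if j = l then g l - g i else 0)"
    by (simp add: sum.distrib)
  also have "(\<Sum>i\<in>UNIV. \<Sum>j\<in>UNIV. if i = l then g l - g j else 0) = (\<Sum>j\<in>UNIV. g l - g j)"
    by (subst sum.swap) simp
  finally show ?thesis
    by simp
qed

text \<open>The Dirichlet moments with parameter \<open>\<kappa> + 1\<close> at l and \<open>\<kappa>\<close> elsewhere solve the recursion.  Exchanging two
  coordinates of x moves the raised parameter to another index, and the sum of the moments over all positions
  of the raised parameter is the moment with all parameters \<open>\<kappa>\<close>.\<close>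

lemma dirichlet_moment_swap_equation:
  fixes x :: "real^'n::finite" and \<kappa> :: real and l :: 'n
  assumes "0 < \<kappa>"
  defines "J \<equiv> \<lambda>m x. dirichlet_moment x m (bump l (\<lambda>_. \<kappa>))"
  shows "real m * J m x + \<kappa> / 2 * (\<Sum>i\<in>UNIV. \<Sum>j\<in>UNIV. J m x - J m (swap_coords i j x))
    = real m * x $ l * J (m - 1) x"
proof -
  let ?g = "\<lambda>j. dirichlet_moment x m (bump j (\<lambda>_. \<kappa>))"
  have swap: "J m (swap_coords i j x) = ?g (Transposition.transpose i j l)" for i j
  proof -
    let ?\<pi> = "Transposition.transpose i j"
    have perm: "?\<pi> permutes UNIV"
      by (rule permutes_swap_id) auto
    have "bump (?\<pi> l) (\<lambda>_. \<kappa>) \<circ> ?\<pi> = bump l (\<lambda>_. \<kappa>)"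
      by (auto simp: bump_def fun_eq_iff inj_eq[OF permutes_inj[OF perm]])
    then show ?thesis
      using dirichlet_moment_permute[OF perm, of x m "bump (?\<pi> l) (\<lambda>_. \<kappa>)"]
      by (simp add: J_def swap_coords_def)
  qed
  have diff: "(\<Sum>j\<in>UNIV. ?g l - ?g j) = real CARD('n) * ?g l - dirichlet_moment x m (\<lambda>_. \<kappa>)"
    using sum_dirichlet_moment_bump[of "\<lambda>_. \<kappa>" x m] assms by (simp add: sum_subtractf)
  have J: "J m x = ?g l"
    by (simp add: J_def)
  have "(real m + real CARD('n) * \<kappa>) * ?g l - \<kappa> * dirichlet_moment x m (\<lambda>_. \<kappa>)
      = real m * x $ l * J (m - 1) x"
    using dirichlet_moment_recurrence[of "\<lambda>_. \<kappa>" m x l] assms by (simp add: J_def)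
  then show ?thesis
    unfolding swap J sum_sum_transpose[of ?g l] diff by (simp add: algebra_simps)
qed

lemma intertwining_power_coord_pos:
  fixes V :: "(real^'n::finite \<Rightarrow> real) \<Rightarrow> real^'n \<Rightarrow> real"
  assumes "0 < \<kappa>" and V: "dunkl_intertwining \<kappa> V"
  shows "V (\<lambda>y. y $ l ^ m) x =
    dirichlet_moment x m (bump l (\<lambda>_. \<kappa>)) / multi_beta (bump l (\<lambda>_. \<kappa>))"
proof -
  let ?a = "bump l (\<lambda>_::'n. \<kappa>)"
  let ?C = "multi_beta ?a"
  have a: "0 < ?a j" for j
    using assms by (intro bump_pos)
  have C: "?C \<noteq> 0"
    using multi_beta_pos[of ?a, OF a] by simp
  have "V (\<lambda>y. y $ l ^ m) = (\<lambda>x. dirichlet_moment x m ?a / ?C)"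
  proof (rule intertwining_power_coord[where q = "\<lambda>m x. dirichlet_moment x m ?a / ?C", OF _ V])
    show "real m * (dirichlet_moment x m ?a / ?C) + \<kappa> / 2 * (\<Sum>i\<in>UNIV. \<Sum>j\<in>UNIV.
        dirichlet_moment x m ?a / ?C - dirichlet_moment (swap_coords i j x) m ?a / ?C)
      = real m * x $ l * (dirichlet_moment x (m - 1) ?a / ?C)" for m x
      using arg_cong[OF dirichlet_moment_swap_equation[OF \<open>0 < \<kappa>\<close>, of m x l], of "\<lambda>r. r / ?C"]
      by (simp only: diff_divide_distrib [symmetric] sum_divide_distrib [symmetric]
          times_divide_eq_right add_divide_distrib)
    show "continuous_on UNIV (\<lambda>x. dirichlet_moment x m ?a / ?C)" for m
      using C by (intro continuous_on_divide continuous_on_const continuous_on_dirichlet_moment) auto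
  qed (use assms C in simp_all)
  then show ?thesis by simp
qed

lemma intertwining_power_coord_zero:
  fixes V :: "(real^'n::finite \<Rightarrow> real) \<Rightarrow> real^'n \<Rightarrow> real"
  assumes "dunkl_intertwining 0 V"
  shows "V (\<lambda>y. y $ l ^ m) = (\<lambda>y. y $ l ^ m)"
proof (rule intertwining_power_coord[OF order_refl assms])
  show "real m * x $ l ^ m + 0 / 2 * (\<Sum>i\<in>UNIV. \<Sum>j\<in>UNIV. x $ l ^ m - swap_coords i j x $ l ^ m)
      = real m * x $ l * x $ l ^ (m - 1)" for m and x :: "real^'n"
    by (cases m) auto
qed (auto intro!: continuous_intros)

lemma intertwining_polynomial_coord:
  fixes V :: "(real^'n::finite \<Rightarrow> real) \<Rightarrow> real^'n \<Rightarrow> real"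
  assumes V: "dunkl_intertwining \<kappa> V"
  shows "V (\<lambda>y. \<Sum>i\<le>N. c i * y $ l ^ i) x = (\<Sum>i\<le>N. c i * V (\<lambda>y. y $ l ^ i) x)"
proof (induction N)
  case 0
  have "V (\<lambda>y. c 0 * y $ l ^ 0 + 0 * y $ l ^ 0) = (\<lambda>x. c 0 * V (\<lambda>y. y $ l ^ 0) x + 0 * V (\<lambda>y. y $ l ^ 0) x)"
    by (rule intertwining_linear[OF V power_coord_polynomial power_coord_polynomial])
  then show ?case by simp
next
  case (Suc N)
  have "real_polynomial_function (\<lambda>y :: real^'n. \<Sum>i\<le>N. c i * y $ l ^ i)"
    by (intro real_polynomial_function_sum real_polynomial_function.intros(4)
        real_polynomial_function.intros(2) power_coord_polynomial finite_atMost)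
  then have "V (\<lambda>y. 1 * (\<Sum>i\<le>N. c i * y $ l ^ i) + c (Suc N) * y $ l ^ Suc N)
      = (\<lambda>x. 1 * V (\<lambda>y. \<Sum>i\<le>N. c i * y $ l ^ i) x + c (Suc N) * V (\<lambda>y. y $ l ^ Suc N) x)"
    by (rule intertwining_linear[OF V _ power_coord_polynomial])
  then show ?case
    using Suc.IH by simp
qed

section \<open>Dirichlet distributions on the simplex\<close>

lemma sum_full_coords: "(\<Sum>j\<in>UNIV. full_coords k t j) = 1" for k :: "'n::finite"
proof -
  have "(\<Sum>j\<in>UNIV. full_coords k t j) = full_coords k t k + (\<Sum>j\<in>UNIV - {k}. full_coords k t j)"
    by (intro sum.remove) auto
  also have "(\<Sum>j\<in>UNIV - {k}. full_coords k t j) = (\<Sum>j\<in>UNIV - {k}. t j)"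
    by (intro sum.cong) (auto simp: full_coords_def)
  finally show ?thesis
    by (simp add: full_coords_def)
qed

lemma full_coords_pos: "t \<in> open_simplex k \<Longrightarrow> 0 < full_coords k t j"
  by (auto simp: open_simplex_def full_coords_def)

lemma full_coords_le_1:
  fixes k :: "'n::finite"
  assumes "t \<in> open_simplex k"
  shows "full_coords k t j \<le> 1"
proof -
  have "full_coords k t j \<le> (\<Sum>j\<in>UNIV. full_coords k t j)"
    using full_coords_pos[OF assms] by (intro member_le_sum) (auto intro: less_imp_le)
  then show ?thesis
    by (simp add: sum_full_coords)
qed

lemma measurable_simplex_component [measurable]:
  assumes "j \<in> UNIV - {k}"
  shows "(\<lambda>t. t j) \<in> borel_measurable (simplex_measure k)"
  using measurable_component_singleton[OF assms, of "\<lambda>_. lborel"] by (simp add: simplex_measure_def)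

lemma measurable_full_coords [measurable]:
  "(\<lambda>t. full_coords k t j) \<in> borel_measurable (simplex_measure k)" for k :: "'n::finite"
proof -
  have *: "(\<lambda>t. full_coords k t j) = (\<lambda>t. if j = k then 1 - (\<Sum>j\<in>UNIV - {k}. t j) else t j)"
    by (auto simp: full_coords_def)
  show ?thesis
    unfolding * by (cases "j = k") auto
qed

lemma open_simplex_eq:
  fixes k :: "'n::finite"
  shows "open_simplex k = {t \<in> space (simplex_measure k). \<forall>j. 0 < full_coords k t j}"
  by (auto simp: open_simplex_def simplex_measure_def space_PiM full_coords_def)

lemma sets_open_simplex [measurable]: "open_simplex k \<in> sets (simplex_measure k)" for k :: "'n::finite"
  unfolding open_simplex_eq by measurable

text \<open>The unnormalised Dirichlet density with parameters a on the simplex, as a function of all coordinates but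
  the one with index k, extended by 0.\<close>

definition dirichlet_weight :: "'n::finite \<Rightarrow> ('n \<Rightarrow> real) \<Rightarrow> ('n \<Rightarrow> real) \<Rightarrow> real" where
  "dirichlet_weight k a t = indicator (open_simplex k) t * (\<Prod>j\<in>UNIV. full_coords k t j powr (a j - 1))"

lemma measurable_dirichlet_weight [measurable]:
  "dirichlet_weight k a \<in> borel_measurable (simplex_measure k)"
  unfolding dirichlet_weight_def by measurable

lemma dirichlet_weight_nonneg: "0 \<le> dirichlet_weight k a t"
  by (auto simp: dirichlet_weight_def intro!: mult_nonneg_nonneg prod_nonneg)

lemma dirichlet_weight_bump: "full_coords k t l * dirichlet_weight k a t = dirichlet_weight k (bump l a) t"
proof (cases "t \<in> open_simplex k")
  case True
  let ?s = "full_coords k t"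
  have "?s j powr (bump l a j - 1) = (if j = l then ?s l else 1) * ?s j powr (a j - 1)" for j
    using full_coords_pos[OF True, of l] powr_mult_base[of "?s l" "a l - 1"]
    by (simp add: bump_def)
  then have "(\<Prod>j\<in>UNIV. ?s j powr (bump l a j - 1)) = ?s l * (\<Prod>j\<in>UNIV. ?s j powr (a j - 1))"
    by (simp add: prod.distrib)
  then show ?thesis
    using True by (simp add: dirichlet_weight_def)
qed (simp add: dirichlet_weight_def)

lemma has_bochner_integral_dirichlet_weight:
  fixes a :: "'n::finite \<Rightarrow> real"
  assumes a: "\<And>j. 0 < a j"
  shows "has_bochner_integral (simplex_measure k) (dirichlet_weight k a)
    (multi_beta a)"
  unfolding multi_beta_def
proof (rule has_bochner_integral_nn_integral)
  let ?I = "UNIV - {k}"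
  have split_sum: "(\<Sum>j\<in>UNIV. a j) = sum a ?I + a k"
    by (simp add: sum.remove[of UNIV k])
  have split_prod: "(\<Prod>j\<in>UNIV. g j) = (\<Prod>j\<in>?I. g j) * g k" for g :: "'n \<Rightarrow> real"
    by (simp add: prod.remove[of UNIV k])
  have "dirichlet_weight k a t = dirichlet_integrand ?I a (a k) 1 t" if "t \<in> space (simplex_measure k)" for t
  proof -
    have "(\<Prod>j\<in>?I. full_coords k t j powr (a j - 1)) = (\<Prod>j\<in>?I. t j powr (a j - 1))"
      by (intro prod.cong) (auto simp: full_coords_def)
    then show ?thesis
      using that
      by (auto simp: dirichlet_weight_def dirichlet_integrand_def split_prod open_simplex_def
          simplex_measure_def space_PiM indicator_def full_coords_def)
  qed
  then have "(\<integral>\<^sup>+t. ennreal (dirichlet_weight k a t) \<partial>simplex_measure k)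
      = (\<integral>\<^sup>+t. ennreal (dirichlet_integrand ?I a (a k) 1 t) \<partial>PiM ?I (\<lambda>_. lborel))"
    unfolding simplex_measure_def by (intro nn_integral_cong) auto
  also have "\<dots> = ennreal ((\<Prod>j\<in>UNIV. Gamma (a j)) / Gamma (\<Sum>j\<in>UNIV. a j))"
    using a by (subst nn_integral_dirichlet) (auto simp: split_sum split_prod)
  finally show "(\<integral>\<^sup>+t. ennreal (dirichlet_weight k a t) \<partial>simplex_measure k)
      = ennreal ((\<Prod>j\<in>UNIV. Gamma (a j)) / Gamma (\<Sum>j\<in>UNIV. a j))" .
  show "0 \<le> (\<Prod>j\<in>UNIV. Gamma (a j)) / Gamma (\<Sum>j\<in>UNIV. a j)"
    using a sum_pos_UNIV[of a]
    by (auto intro!: divide_nonneg_pos prod_nonneg Gamma_real_pos less_imp_le[OF Gamma_real_pos])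
qed (auto simp: dirichlet_weight_nonneg)

text \<open>The linear form \<open>x\<^sub>1 t\<^sub>1 + \<dots> + x\<^sub>n t\<^sub>n\<close> on the simplex.\<close>

definition simplex_point :: "real^'n::finite \<Rightarrow> 'n \<Rightarrow> ('n \<Rightarrow> real) \<Rightarrow> real" where
  "simplex_point x k t = (\<Sum>j\<in>UNIV. x $ j * full_coords k t j)"

lemma measurable_simplex_point [measurable]:
  "simplex_point x k \<in> borel_measurable (simplex_measure k)"
  unfolding simplex_point_def by measurable

lemma has_bochner_integral_simplex_point_power:
  fixes a :: "'n::finite \<Rightarrow> real"
  assumes "\<And>j. 0 < a j"
  shows "has_bochner_integral (simplex_measure k) (\<lambda>t. simplex_point x k t ^ m * dirichlet_weight k a t)
    (dirichlet_moment x m a)"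
  using assms
proof (induction m arbitrary: a)
  case 0
  then show ?case
    using has_bochner_integral_dirichlet_weight[of a k] by simp
next
  case (Suc m)
  have "simplex_point x k t ^ Suc m * dirichlet_weight k a t
      = (\<Sum>j\<in>UNIV. x $ j * (simplex_point x k t ^ m * dirichlet_weight k (bump j a) t))" for t
    unfolding dirichlet_weight_bump [symmetric]
    by (simp add: simplex_point_def sum_distrib_right sum_distrib_left mult_ac)
  moreover have "has_bochner_integral (simplex_measure k)
      (\<lambda>t. \<Sum>j\<in>UNIV. x $ j * (simplex_point x k t ^ m * dirichlet_weight k (bump j a) t))
      (\<Sum>j\<in>UNIV. x $ j * dirichlet_moment x m (bump j a))"
    using Suc.prems
    by (intro has_bochner_integral_sum has_bochner_integral_mult_right Suc.IH bump_pos)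
  ultimately show ?case
    by simp
qed

text \<open>The Dirichlet distribution with parameters a; it is a probability measure when all of them are positive.\<close>

definition dirichlet_measure :: "'n::finite \<Rightarrow> ('n \<Rightarrow> real) \<Rightarrow> ('n \<Rightarrow> real) measure" where
  "dirichlet_measure k a = density (simplex_measure k)
     (\<lambda>t. ennreal (dirichlet_weight k a t / multi_beta a))"

lemma sets_dirichlet_measure [measurable_cong]: "sets (dirichlet_measure k a) = sets (simplex_measure k)"
  by (simp add: dirichlet_measure_def)

lemma has_bochner_integral_dirichlet_measure:
  fixes a :: "'n::finite \<Rightarrow> real" and f :: "('n \<Rightarrow> real) \<Rightarrow> real"
  assumes "\<And>j. 0 < a j" and [measurable]: "f \<in> borel_measurable (simplex_measure k)"
    and "has_bochner_integral (simplex_measure k) (\<lambda>t. f t * dirichlet_weight k a t) I"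
  shows "has_bochner_integral (dirichlet_measure k a) f (I / multi_beta a)"
  unfolding dirichlet_measure_def
proof (rule has_bochner_integral_density)
  show "has_bochner_integral (simplex_measure k)
      (\<lambda>t. (dirichlet_weight k a t / multi_beta a) *\<^sub>R f t) (I / multi_beta a)"
    using has_bochner_integral_divide_zero[OF assms(3), of "multi_beta a"]
    by (simp add: mult.commute)
qed (use multi_beta_pos[of a] assms in \<open>auto simp: dirichlet_weight_nonneg less_imp_le\<close>)

lemma prob_space_dirichlet_measure:
  fixes a :: "'n::finite \<Rightarrow> real"
  assumes a: "\<And>j. 0 < a j"
  shows "prob_space (dirichlet_measure k a)"
proof
  have pos: "0 < multi_beta a"
    by (rule multi_beta_pos) (rule a)
  have "has_bochner_integral (simplex_measure k) (\<lambda>t. dirichlet_weight k a t / multi_beta a) 1"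
    using has_bochner_integral_divide_zero[OF has_bochner_integral_dirichlet_weight[of a k, OF a],
        of "multi_beta a"] pos
    by simp
  then have "(\<integral>\<^sup>+t. ennreal (dirichlet_weight k a t / multi_beta a) \<partial>simplex_measure k) = 1"
    using pos by (subst nn_integral_eq_integral)
      (auto simp: has_bochner_integral_iff dirichlet_weight_nonneg)
  then show "emeasure (dirichlet_measure k a) (space (dirichlet_measure k a)) = 1"
    by (simp add: dirichlet_measure_def emeasure_density cong: nn_integral_cong)
qed

lemma AE_dirichlet_measure: "AE t in dirichlet_measure k a. t \<in> open_simplex k"
proof -
  have "(\<lambda>t. ennreal (dirichlet_weight k a t / multi_beta a)) \<in> borel_measurable (simplex_measure k)"
    by measurable
  then show ?thesis
    unfolding dirichlet_measure_def by (subst AE_density) (auto simp: dirichlet_weight_def indicator_def)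
qed

text \<open>The factor with index l in the integrand raises the parameter with index l from \<open>\<kappa>\<close> to \<open>\<kappa> + 1\<close>.\<close>

lemma simplex_integrand_eq:
  "indicator (open_simplex k) t * simplex_integrand \<kappa> k l f x t
    = dirichlet_weight k (bump l (\<lambda>_. \<kappa>)) t * f (simplex_point x k t)"
  unfolding dirichlet_weight_bump [symmetric]
  by (simp add: simplex_integrand_def Let_def mult_ac dirichlet_weight_def simplex_point_def)

lemma dirichlet_const_eq:
  fixes l :: "'n::finite"
  assumes "0 < \<kappa>"
  shows "real CARD('n) * dirichlet_const \<kappa> CARD('n) = 1 / multi_beta (bump l (\<lambda>_. \<kappa>))"
proof -
  have "real CARD('n) * \<kappa> * multi_beta (bump l (\<lambda>_. \<kappa>)) = \<kappa> * multi_beta (\<lambda>_::'n. \<kappa>)"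
    using multi_beta_bump[of "\<lambda>_. \<kappa>" l] assms by simp
  then have mb: "multi_beta (\<lambda>_::'n. \<kappa>) = real CARD('n) * multi_beta (bump l (\<lambda>_. \<kappa>))"
    using assms by simp
  have "dirichlet_const \<kappa> CARD('n) = 1 / multi_beta (\<lambda>_::'n. \<kappa>)"
    by (simp add: dirichlet_const_def multi_beta_def)
  then show ?thesis
    unfolding mb by simp
qed

text \<open>The law of the linear form given by x under the Dirichlet distribution with parameters a.\<close>

definition simplex_law :: "real^'n::finite \<Rightarrow> 'n \<Rightarrow> ('n \<Rightarrow> real) \<Rightarrow> real measure" where
  "simplex_law x k a = distr (dirichlet_measure k a) borel (simplex_point x k)"

lemma simplex_law_integral:
  fixes x :: "real^'n::finite" and f :: "real \<Rightarrow> real"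
  assumes "0 < \<kappa>" and f [measurable]: "f \<in> borel_measurable borel"
  shows "integrable (simplex_law x k (bump l (\<lambda>_. \<kappa>))) f \<longleftrightarrow>
      set_integrable (simplex_measure k) (open_simplex k) (simplex_integrand \<kappa> k l f x)"
    and "integral\<^sup>L (simplex_law x k (bump l (\<lambda>_. \<kappa>))) f = simplex_formula \<kappa> k l f x"
proof -
  let ?a = "bump l (\<lambda>_. \<kappa>)"
  let ?Z = "multi_beta ?a"
  have pos: "0 < ?Z"
    using assms by (intro multi_beta_pos bump_pos)
  have nonneg: "AE t in simplex_measure k. 0 \<le> dirichlet_weight k ?a t / ?Z"
    using pos by (intro AE_I2 divide_nonneg_pos dirichlet_weight_nonneg)
  have *: "(dirichlet_weight k ?a t / ?Z) *\<^sub>R f (simplex_point x k t)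
      = 1 / ?Z * (indicator (open_simplex k) t *\<^sub>R simplex_integrand \<kappa> k l f x t)" for t
    by (simp add: simplex_integrand_eq)
  have "integrable (simplex_law x k ?a) f \<longleftrightarrow> integrable (dirichlet_measure k ?a) (\<lambda>t. f (simplex_point x k t))"
    unfolding simplex_law_def by (intro integrable_distr_eq) auto
  also have "\<dots> \<longleftrightarrow> integrable (simplex_measure k)
      (\<lambda>t. 1 / ?Z * (indicator (open_simplex k) t *\<^sub>R simplex_integrand \<kappa> k l f x t))"
    unfolding dirichlet_measure_def * [symmetric] using nonneg by (intro integrable_density) auto
  also have "\<dots> \<longleftrightarrow> set_integrable (simplex_measure k) (open_simplex k) (simplex_integrand \<kappa> k l f x)"
    using pos unfolding set_integrable_def by (subst integrable_mult_left_iff) auto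
  finally show "integrable (simplex_law x k ?a) f \<longleftrightarrow>
      set_integrable (simplex_measure k) (open_simplex k) (simplex_integrand \<kappa> k l f x)" .
  have "integral\<^sup>L (simplex_law x k ?a) f = (\<integral>t. f (simplex_point x k t) \<partial>dirichlet_measure k ?a)"
    unfolding simplex_law_def by (intro integral_distr) auto
  also have "\<dots> = (\<integral>t. 1 / ?Z * (indicator (open_simplex k) t *\<^sub>R simplex_integrand \<kappa> k l f x t) \<partial>simplex_measure k)"
    unfolding dirichlet_measure_def * [symmetric] using nonneg by (intro integral_density) auto
  also have "\<dots> = 1 / ?Z * (LINT t:open_simplex k|simplex_measure k. simplex_integrand \<kappa> k l f x t)"
    unfolding set_lebesgue_integral_def by (rule integral_mult_right_zero)
  finally show "integral\<^sup>L (simplex_law x k ?a) f = simplex_formula \<kappa> k l f x"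
    unfolding simplex_formula_def dirichlet_const_eq[OF \<open>0 < \<kappa>\<close> , of l] .
qed

lemma real_distribution_simplex_law:
  "real_distribution (simplex_law x k a)" if "\<And>j. 0 < a j"
proof -
  interpret prob_space "dirichlet_measure k a"
    using that by (rule prob_space_dirichlet_measure)
  show ?thesis
    unfolding simplex_law_def by (intro real_distribution_distr) measurable
qed

lemma has_bochner_integral_simplex_law_power:
  assumes a: "\<And>j. 0 < a j"
  shows "has_bochner_integral (simplex_law x k a) (\<lambda>u. u ^ m)
    (dirichlet_moment x m a / multi_beta a)"
proof -
  have "has_bochner_integral (dirichlet_measure k a) (\<lambda>t. simplex_point x k t ^ m)
      (dirichlet_moment x m a / multi_beta a)"
    using a by (intro has_bochner_integral_dirichlet_measure has_bochner_integral_simplex_point_power) auto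
  then show ?thesis
    unfolding simplex_law_def by (intro has_bochner_integral_distr) auto
qed

lemma abs_simplex_point_le:
  assumes "t \<in> open_simplex k"
  shows "\<bar>simplex_point x k t\<bar> \<le> (\<Sum>j\<in>UNIV. \<bar>x $ j\<bar>)"
proof -
  have "\<bar>simplex_point x k t\<bar> \<le> (\<Sum>j\<in>UNIV. \<bar>x $ j * full_coords k t j\<bar>)"
    unfolding simplex_point_def by (rule sum_abs)
  also have "\<dots> \<le> (\<Sum>j\<in>UNIV. \<bar>x $ j\<bar>)"
    using full_coords_pos[OF assms] full_coords_le_1[OF assms]
    by (intro sum_mono) (auto simp: abs_mult abs_of_pos intro!: mult_left_le)
  finally show ?thesis .
qed

lemma AE_simplex_law: "AE u in simplex_law x k a. \<bar>u\<bar> \<le> (\<Sum>j\<in>UNIV. \<bar>x $ j\<bar>)"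
  unfolding simplex_law_def
  by (subst AE_distr_iff) (use AE_dirichlet_measure[of k a] abs_simplex_point_le in \<open>auto elim!: AE_mp\<close>)

section \<open>Determinacy of moments\<close>

text \<open>Determinacy of the moment problem when one of the two laws has bounded support.  The moments of even order
  grow at most geometrically, so the Taylor polynomials converge to both characteristic functions.\<close>

lemma real_distribution_eqI_moments:
  fixes M N :: "real measure"
  assumes M: "real_distribution M" and N: "real_distribution N"
    and "0 \<le> R" and bound: "AE x in N. \<bar>x\<bar> \<le> R"
    and int_M: "\<And>m. integrable M (\<lambda>x. x ^ m)"
    and int_N: "\<And>m. integrable N (\<lambda>x. x ^ m)"
    and moments: "\<And>m. (\<integral>x. x ^ m \<partial>M) = (\<integral>x. x ^ m \<partial>N)"
  shows "M = N"
proof (rule Levy_uniqueness[OF M N], rule ext)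
  fix t
  interpret M: real_distribution M by (rule M)
  interpret N: real_distribution N by (rule N)
  have even_moment: "(\<integral>x. \<bar>x\<bar> ^ (2 * n) \<partial>N) \<le> R ^ (2 * n)" for n
  proof -
    have "(\<integral>x. \<bar>x\<bar> ^ (2 * n) \<partial>N) \<le> (\<integral>x. R ^ (2 * n) \<partial>N)"
    proof (rule integral_mono_AE)
      show "integrable N (\<lambda>x. \<bar>x\<bar> ^ (2 * n))"
        using int_N[of "2 * n"] by (simp add: power_even_abs)
      show "AE x in N. \<bar>x\<bar> ^ (2 * n) \<le> R ^ (2 * n)"
        using bound by eventually_elim (auto intro: power_mono)
    qed simp
    then show ?thesis
      using N.prob_space by simp
  qed
  have est: "cmod (char M t - char N t) \<le> 4 * (inverse (fact (2 * n)) * (\<bar>t\<bar> * R) ^ (2 * n))" for n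
  proof -
    let ?T = "\<Sum>k\<le>2 * n. ((\<i> * t) ^ k / fact k) * (\<integral>x. x ^ k \<partial>N)"
    let ?c = "2 * \<bar>t\<bar> ^ (2 * n) / fact (2 * n)"
    have N_le: "cmod (char N t - ?T) \<le> ?c * (\<integral>x. \<bar>x\<bar> ^ (2 * n) \<partial>N)"
      using N.char_approx1[of "2 * n" t] int_N by simp
    have "(\<integral>x. \<bar>x\<bar> ^ (2 * n) \<partial>M) = (\<integral>x. \<bar>x\<bar> ^ (2 * n) \<partial>N)"
      using moments[of "2 * n"] by (simp add: power_even_abs)
    then have M_le: "cmod (char M t - ?T) \<le> ?c * (\<integral>x. \<bar>x\<bar> ^ (2 * n) \<partial>N)"
      using M.char_approx1[of "2 * n" t] int_M moments by simp
    have "cmod (char M t - char N t) \<le> cmod (char M t - ?T) + cmod (char N t - ?T)"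
      using norm_triangle_ineq4[of "char M t - ?T" "char N t - ?T"] by simp
    also have "\<dots> \<le> 2 * (?c * R ^ (2 * n))"
      using M_le N_le mult_left_mono[OF even_moment[of n], of ?c] by simp
    finally show ?thesis
      by (simp add: power_mult_distrib field_simps)
  qed
  have "(\<lambda>n. inverse (fact n) * (\<bar>t\<bar> * R) ^ n) \<longlonglongrightarrow> 0"
    by (rule summable_LIMSEQ_zero[OF summable_exp])
  then have "(\<lambda>n. inverse (fact (2 * n)) * (\<bar>t\<bar> * R) ^ (2 * n)) \<longlonglongrightarrow> 0"
    using LIMSEQ_subseq_LIMSEQ[of _ 0 "\<lambda>n. 2 * n"] by (force simp: strict_mono_def comp_def)
  then have "(\<lambda>n. 4 * (inverse (fact (2 * n)) * (\<bar>t\<bar> * R) ^ (2 * n))) \<longlonglongrightarrow> 4 * 0"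
    by (rule tendsto_mult_left)
  then have "cmod (char M t - char N t) \<le> 4 * 0"
    by (rule LIMSEQ_le_const) (intro exI allI impI est)
  then show "char M t = char N t"
    by simp
qed

section \<open>The integral formula for positive parameter\<close>

lemma
  fixes M :: "(real^'n::finite) measure"
  assumes "represents_at V x M"
  shows represents_at_moment:
      "has_bochner_integral M (\<lambda>y. y $ l ^ m) (V (\<lambda>y. y $ l ^ m) x)"
    and represents_at_prob_space: "prob_space M"
    and represents_at_sets: "sets M = sets borel"
    and represents_at_coord: "(\<lambda>y. y $ l) \<in> borel_measurable M"
proof -
  show *: "prob_space M" "sets M = sets borel"
    using assms by (auto simp: represents_at_def)
  show "has_bochner_integral M (\<lambda>y. y $ l ^ m) (V (\<lambda>y. y $ l ^ m) x)"
    using assms power_coord_polynomial[of l m] by (auto simp: represents_at_def has_bochner_integral_iff)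
  show "(\<lambda>y. y $ l) \<in> borel_measurable M"
    by (subst measurable_cong_sets[OF *(2) refl]) auto
qed

lemma distr_coord_eq_simplex_law:
  fixes x :: "real^'n::finite"
  assumes "0 < \<kappa>" and V: "dunkl_intertwining \<kappa> V" and M: "represents_at V x M"
  shows "distr M borel (\<lambda>y. y $ l) = simplex_law x k (bump l (\<lambda>_. \<kappa>))"
proof -
  let ?a = "bump l (\<lambda>_. \<kappa>)"
  let ?N = "distr M borel (\<lambda>y. y $ l)"
  note [measurable] = represents_at_coord[OF M]
  interpret M: prob_space M
    using M by (rule represents_at_prob_space)
  have a: "0 < ?a j" for j
    using \<open>0 < \<kappa>\<close> by (intro bump_pos)
  have moment: "has_bochner_integral ?N (\<lambda>u. u ^ m) (dirichlet_moment x m ?a / multi_beta ?a)" for m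
    using represents_at_moment[OF M, of l m] intertwining_power_coord_pos[OF \<open>0 < \<kappa>\<close> V, of l m x]
    by (intro has_bochner_integral_distr) auto
  show ?thesis
  proof (rule real_distribution_eqI_moments)
    show "real_distribution ?N"
      by (intro M.real_distribution_distr) measurable
    show "real_distribution (simplex_law x k ?a)"
      using a by (rule real_distribution_simplex_law)
    show "AE u in simplex_law x k ?a. \<bar>u\<bar> \<le> (\<Sum>j\<in>UNIV. \<bar>x $ j\<bar>)"
      by (rule AE_simplex_law)
    show "0 \<le> (\<Sum>j\<in>UNIV. \<bar>x $ j\<bar>)"
      by (intro sum_nonneg) auto
  qed (use moment has_bochner_integral_simplex_law_power[of ?a x k, OF a] in
      \<open>auto simp: has_bochner_integral_iff\<close>)
qed

lemma intertwining_polynomial_eq_simplex_formula: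
  fixes x :: "real^'n::finite"
  assumes "0 < \<kappa>" and V: "dunkl_intertwining \<kappa> V" and f: "real_polynomial_function f"
  shows "set_integrable (simplex_measure k) (open_simplex k) (simplex_integrand \<kappa> k l f x)"
    and "V (\<lambda>y. f (y $ l)) x = simplex_formula \<kappa> k l f x"
proof -
  let ?a = "bump l (\<lambda>_. \<kappa>)"
  obtain c N where f_eq: "f = (\<lambda>u. \<Sum>i\<le>N. c i * u ^ i)"
    using f by (auto simp: real_polynomial_function_iff_sum)
  have f_borel: "f \<in> borel_measurable borel"
    unfolding f_eq by measurable
  have "has_bochner_integral (simplex_law x k ?a) f
      (\<Sum>i\<le>N. c i * (dirichlet_moment x i ?a / multi_beta ?a))"
    unfolding f_eq using \<open>0 < \<kappa>\<close>
    by (intro has_bochner_integral_sum has_bochner_integral_mult_right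
        has_bochner_integral_simplex_law_power bump_pos)
  also have "(\<Sum>i\<le>N. c i * (dirichlet_moment x i ?a / multi_beta ?a)) = V (\<lambda>y. f (y $ l)) x"
    unfolding f_eq intertwining_polynomial_coord[OF V]
    by (simp add: intertwining_power_coord_pos[OF \<open>0 < \<kappa>\<close> V])
  finally show "set_integrable (simplex_measure k) (open_simplex k) (simplex_integrand \<kappa> k l f x)"
    "V (\<lambda>y. f (y $ l)) x = simplex_formula \<kappa> k l f x"
    using simplex_law_integral[OF \<open>0 < \<kappa>\<close> f_borel, of x k l]
    by (auto simp: has_bochner_integral_iff)
qed

section \<open>The limiting case of parameter zero\<close>

lemma has_bochner_integral_full_coords:
  fixes a :: "'n::finite \<Rightarrow> real"
  assumes "\<And>j. 0 < a j"
  shows "has_bochner_integral (dirichlet_measure k a) (\<lambda>t. full_coords k t l) (a l / (\<Sum>j\<in>UNIV. a j))"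
proof -
  have "has_bochner_integral (dirichlet_measure k a) (\<lambda>t. full_coords k t l)
      (multi_beta (bump l a) / multi_beta a)"
    using assms
    by (intro has_bochner_integral_dirichlet_measure)
       (auto simp: dirichlet_weight_bump intro: has_bochner_integral_dirichlet_weight bump_pos)
  moreover have "multi_beta (bump l a) / multi_beta a = a l / (\<Sum>j\<in>UNIV. a j)"
    using multi_beta_bump[of a l] multi_beta_pos[of a] sum_pos_UNIV[of a] assms
    by (simp add: frac_eq_eq mult.commute)
  ultimately show ?thesis by simp
qed

lemma abs_simplex_point_diff_le:
  assumes t: "t \<in> open_simplex k"
  shows "\<bar>simplex_point x k t - x $ l\<bar> \<le> 2 * (\<Sum>j\<in>UNIV. \<bar>x $ j\<bar>) * (1 - full_coords k t l)"
proof -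
  let ?s = "full_coords k t" and ?R = "\<Sum>j\<in>UNIV. \<bar>x $ j\<bar>"
  have abs_le: "\<bar>x $ j\<bar> \<le> ?R" for j
    by (intro member_le_sum) auto
  have "simplex_point x k t - x $ l = (\<Sum>j\<in>UNIV. (x $ j - x $ l) * ?s j)"
    by (simp add: simplex_point_def left_diff_distrib sum_subtractf sum_full_coords
        flip: sum_distrib_left)
  also have "\<bar>\<dots>\<bar> \<le> (\<Sum>j\<in>UNIV. \<bar>(x $ j - x $ l) * ?s j\<bar>)"
    by (rule sum_abs)
  also have "\<dots> \<le> (\<Sum>j\<in>UNIV. 2 * ?R * (if j = l then 0 else ?s j))"
  proof (rule sum_mono)
    fix j
    have "\<bar>x $ j - x $ l\<bar> \<le> 2 * ?R"
      using abs_le[of j] abs_le[of l] by linarith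
    then show "\<bar>(x $ j - x $ l) * ?s j\<bar> \<le> 2 * ?R * (if j = l then 0 else ?s j)"
      using full_coords_pos[OF t, of j] by (auto simp: abs_mult intro: mult_right_mono)
  qed
  also have "\<dots> = 2 * ?R * (\<Sum>j\<in>UNIV. ?s j - (if j = l then ?s l else 0))"
    unfolding sum_distrib_left by (intro sum.cong) auto
  also have "\<dots> = 2 * ?R * (1 - ?s l)"
    by (simp add: sum_subtractf sum_full_coords)
  finally show ?thesis .
qed

text \<open>The limit at \<open>\<kappa> = 0\<close>.  The coordinate with index l has mean \<open>(\<epsilon> + 1) / (n * \<epsilon> + 1)\<close>, which tends to 1, so the
  Dirichlet distributions concentrate at the vertex with index l.\<close>

lemma simplex_formula_tendsto:
  fixes x :: "real^'n::finite" and f :: "real \<Rightarrow> real"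
  assumes f: "continuous_on UNIV f"
  shows "((\<lambda>\<epsilon>. simplex_formula \<epsilon> k l f x) \<longlongrightarrow> f (x $ l)) (at_right 0)"
proof (rule tendstoI)
  fix e :: real assume "0 < e"
  let ?R = "\<Sum>j\<in>UNIV. \<bar>x $ j\<bar>"
  let ?n = "real CARD('n)"
  have [measurable]: "f \<in> borel_measurable borel"
    using f by (rule borel_measurable_continuous_onI)
  have x_le: "\<bar>x $ l\<bar> \<le> ?R"
    by (intro member_le_sum) auto
  have "bounded (f ` {-?R..?R})"
    by (intro compact_imp_bounded compact_continuous_image continuous_on_subset[OF f]) auto
  then obtain B where "0 < B" and B: "\<And>u. \<bar>u\<bar> \<le> ?R \<Longrightarrow> \<bar>f u\<bar> \<le> B"
    by (force simp: bounded_pos abs_le_iff)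
  obtain \<delta> where "0 < \<delta>" and \<delta>: "\<And>u. \<bar>u - x $ l\<bar> < \<delta> \<Longrightarrow> \<bar>f u - f (x $ l)\<bar> < e / 2"
    using f \<open>0 < e\<close> unfolding continuous_on_iff dist_real_def
    by (metis UNIV_I half_gt_zero)
  \<comment> \<open>Away from \<open>x $ l\<close> the linear term is at least the bound 2 B for the oscillation of f.\<close>
  have f_le: "\<bar>f u - f (x $ l)\<bar> \<le> e / 2 + 2 * B / \<delta> * \<bar>u - x $ l\<bar>" if u: "\<bar>u\<bar> \<le> ?R" for u
  proof (cases "\<bar>u - x $ l\<bar> < \<delta>")
    case True
    moreover have "0 \<le> 2 * B / \<delta> * \<bar>u - x $ l\<bar>"
      using \<open>0 < B\<close> \<open>0 < \<delta>\<close> by simp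
    ultimately show ?thesis
      using \<delta>[of u] by linarith
  next
    case False
    then have "2 * B * 1 \<le> 2 * B * (\<bar>u - x $ l\<bar> / \<delta>)"
      using \<open>0 < B\<close> \<open>0 < \<delta>\<close> by (intro mult_left_mono) auto
    moreover have "\<bar>f u - f (x $ l)\<bar> \<le> 2 * B"
      using B[OF u] B[OF x_le] by linarith
    ultimately show ?thesis
      using \<open>0 < e\<close> by simp
  qed
  define C where "C = 2 * B / \<delta> * (2 * ?R)"
  have est: "\<bar>simplex_formula \<epsilon> k l f x - f (x $ l)\<bar> \<le> e / 2 + C * (1 - (\<epsilon> + 1) / (?n * \<epsilon> + 1))"
    if "0 < \<epsilon>" for \<epsilon>
  proof -
    let ?a = "bump l (\<lambda>_. \<epsilon>)"
    let ?D = "dirichlet_measure k ?a"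
    have a: "0 < ?a j" for j
      using \<open>0 < \<epsilon>\<close> by (intro bump_pos)
    interpret D: prob_space ?D
      using a by (rule prob_space_dirichlet_measure)
    have coord: "has_bochner_integral ?D (\<lambda>t. full_coords k t l) ((\<epsilon> + 1) / (?n * \<epsilon> + 1))"
      using has_bochner_integral_full_coords[of ?a k l, OF a] by (simp add: sum_bump) (simp add: bump_def)
    have g_le: "AE t in ?D. \<bar>f (simplex_point x k t) - f (x $ l)\<bar> \<le> e / 2 + C * (1 - full_coords k t l)"
      using AE_dirichlet_measure[of k ?a]
    proof eventually_elim
      case (elim t)
      have "2 * B / \<delta> * \<bar>simplex_point x k t - x $ l\<bar> \<le> 2 * B / \<delta> * (2 * ?R * (1 - full_coords k t l))"
        using \<open>0 < B\<close> \<open>0 < \<delta>\<close> by (intro mult_left_mono abs_simplex_point_diff_le elim) auto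
      then show ?case
        using f_le[OF abs_simplex_point_le[OF elim]] by (simp add: C_def mult.assoc)
    qed
    have f_int: "integrable ?D (\<lambda>t. f (simplex_point x k t))"
    proof (rule D.integrable_const_bound)
      show "AE t in ?D. norm (f (simplex_point x k t)) \<le> B"
        using AE_dirichlet_measure[of k ?a] by eventually_elim (use B abs_simplex_point_le in auto)
    qed measurable
    have "simplex_formula \<epsilon> k l f x = (\<integral>t. f (simplex_point x k t) \<partial>?D)"
      unfolding simplex_law_integral(2)[OF \<open>0 < \<epsilon>\<close> \<open>f \<in> borel_measurable borel\<close>, symmetric] simplex_law_def
      by (intro integral_distr) auto
    then have "simplex_formula \<epsilon> k l f x - f (x $ l) = (\<integral>t. f (simplex_point x k t) - f (x $ l) \<partial>?D)"
      using f_int by (simp add: D.prob_space)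
    also have "\<bar>\<dots>\<bar> \<le> (\<integral>t. \<bar>f (simplex_point x k t) - f (x $ l)\<bar> \<partial>?D)"
      by (rule integral_abs_bound)
    also have "\<dots> \<le> (\<integral>t. e / 2 + C * (1 - full_coords k t l) \<partial>?D)"
      using f_int coord g_le by (intro integral_mono_AE) (auto simp: has_bochner_integral_iff)
    also have "\<dots> = e / 2 + C * (1 - (\<epsilon> + 1) / (?n * \<epsilon> + 1))"
      using coord by (simp add: has_bochner_integral_iff D.prob_space)
    finally show ?thesis .
  qed
  have "((\<lambda>\<epsilon>. C * (1 - (\<epsilon> + 1) / (?n * \<epsilon> + 1))) \<longlongrightarrow> C * (1 - (0 + 1) / (?n * 0 + 1))) (at_right 0)"
    by (intro tendsto_intros) auto
  then have "((\<lambda>\<epsilon>. C * (1 - (\<epsilon> + 1) / (?n * \<epsilon> + 1))) \<longlongrightarrow> 0) (at_right 0)"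
    by simp
  then have "\<forall>\<^sub>F \<epsilon> in at_right 0. C * (1 - (\<epsilon> + 1) / (?n * \<epsilon> + 1)) < e / 2"
    using \<open>0 < e\<close> by (intro order_tendstoD) auto
  with eventually_at_right_less[of 0]
  show "\<forall>\<^sub>F \<epsilon> in at_right 0. dist (simplex_formula \<epsilon> k l f x) (f (x $ l)) < e"
  proof eventually_elim
    case (elim \<epsilon>)
    then show ?case
      using est[OF elim(1)] unfolding dist_real_def by linarith
  qed
qed

text \<open>For \<open>\<kappa> = 0\<close> the operator V fixes the powers of a coordinate, so under a representing measure the coordinate
  has mean \<open>x $ l\<close> and variance 0.\<close>

lemma AE_represents_at_zero:
  fixes x :: "real^'n::finite"
  assumes V: "dunkl_intertwining 0 V" and M: "represents_at V x M"
  shows "AE y in M. y $ l = x $ l"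
proof -
  interpret M: prob_space M
    using M by (rule represents_at_prob_space)
  have moment: "has_bochner_integral M (\<lambda>y. y $ l ^ m) (x $ l ^ m)" for m
    using represents_at_moment[OF M, of l m] by (simp add: intertwining_power_coord_zero[OF V])
  have eq: "(y $ l - x $ l)\<^sup>2 = y $ l ^ 2 - 2 * x $ l * y $ l ^ 1 + (x $ l)\<^sup>2 * y $ l ^ 0" for y :: "real^'n"
    by (simp add: power2_eq_square algebra_simps)
  have "has_bochner_integral M (\<lambda>y. (y $ l - x $ l)\<^sup>2)
      (x $ l ^ 2 - 2 * x $ l * x $ l ^ 1 + (x $ l)\<^sup>2 * x $ l ^ 0)"
    unfolding eq
    by (intro has_bochner_integral_add has_bochner_integral_diff has_bochner_integral_mult_right moment)
  then have "has_bochner_integral M (\<lambda>y. (y $ l - x $ l)\<^sup>2) 0"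
    by (simp add: power2_eq_square)
  then have "AE y in M. (y $ l - x $ l)\<^sup>2 = 0"
    using integral_nonneg_eq_0_iff_AE[of M "\<lambda>y. (y $ l - x $ l)\<^sup>2"]
    by (auto simp: has_bochner_integral_iff)
  then show ?thesis
    by simp
qed

lemma represents_at_zero_integral:
  fixes x :: "real^'n::finite" and f :: "real \<Rightarrow> real"
  assumes V: "dunkl_intertwining 0 V" and M: "represents_at V x M"
    and f: "f \<in> borel_measurable borel"
  shows "has_bochner_integral M (\<lambda>y. f (y $ l)) (f (x $ l))"
proof -
  interpret M: prob_space M
    using M by (rule represents_at_prob_space)
  note [measurable] = represents_at_coord[OF M] f
  have "AE y in M. f (x $ l) = f (y $ l)"
    using AE_represents_at_zero[OF V M, of l] by eventually_elim simp
  moreover have "has_bochner_integral M (\<lambda>y. f (x $ l)) (f (x $ l))"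
    by (simp add: has_bochner_integral_iff M.prob_space)
  ultimately show ?thesis
    by (subst has_bochner_integral_cong_AE[symmetric]) auto
qed

lemma intertwining_zero_polynomial:
  fixes x :: "real^'n::finite"
  assumes V: "dunkl_intertwining 0 V" and f: "real_polynomial_function f"
  shows "V (\<lambda>y. f (y $ l)) x = f (x $ l)"
proof -
  obtain c N where "f = (\<lambda>u. \<Sum>i\<le>N. c i * u ^ i)"
    using f by (auto simp: real_polynomial_function_iff_sum)
  then show ?thesis
    by (simp add: intertwining_polynomial_coord[OF V] intertwining_power_coord_zero[OF V])
qed

section \<open>The integral formula for nonnegative parameter\<close>

theorem theorem4p5:
  fixes \<kappa> :: real
    and V :: "(real^'n::finite \<Rightarrow> real) \<Rightarrow> real^'n \<Rightarrow> real"
    and k l :: 'n and x :: "real^'n"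
  assumes "0 \<le> \<kappa>" and "dunkl_intertwining \<kappa> V"
  shows
    "(0 < \<kappa> \<longrightarrow>
       real CARD('n) * dirichlet_const \<kappa> CARD('n)
         = Gamma (real CARD('n) * \<kappa> + 1) / (\<kappa> * Gamma \<kappa> ^ CARD('n)) \<and>
       (\<forall>f :: real \<Rightarrow> real. real_polynomial_function f \<longrightarrow>
          set_integrable (simplex_measure k) (open_simplex k) (simplex_integrand \<kappa> k l f x) \<and>
          V (\<lambda>y. f (y $ l)) x = simplex_formula \<kappa> k l f x) \<and>
       (\<forall>(f :: real \<Rightarrow> real) M. represents_at V x M \<longrightarrow> f \<in> borel_measurable borel \<longrightarrow>
          (integrable M (\<lambda>y. f (y $ l)) \<longleftrightarrow>
             set_integrable (simplex_measure k) (open_simplex k) (simplex_integrand \<kappa> k l f x)) \<and>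
          (\<integral>y. f (y $ l) \<partial>M) = simplex_formula \<kappa> k l f x)) \<and>
     (\<kappa> = 0 \<longrightarrow>
       (\<forall>f :: real \<Rightarrow> real. real_polynomial_function f \<longrightarrow>
          ((\<lambda>\<epsilon>. simplex_formula \<epsilon> k l f x) \<longlongrightarrow> V (\<lambda>y. f (y $ l)) x) (at_right 0)) \<and>
       (\<forall>(f :: real \<Rightarrow> real) M. represents_at V x M \<longrightarrow> continuous_on UNIV f \<longrightarrow>
          ((\<lambda>\<epsilon>. simplex_formula \<epsilon> k l f x) \<longlongrightarrow> (\<integral>y. f (y $ l) \<partial>M)) (at_right 0)) \<and>
       (\<forall>(f :: real \<Rightarrow> real) M. represents_at V x M \<longrightarrow> f \<in> borel_measurable borel \<longrightarrow>
          integrable M (\<lambda>y. f (y $ l)) \<and> (\<integral>y. f (y $ l) \<partial>M) = f (x $ l)))"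
proof (intro conjI[where Q = "\<kappa> = 0 \<longrightarrow> _"] impI)
  assume \<kappa>: "0 < \<kappa>"
  have "real CARD('n) * dirichlet_const \<kappa> CARD('n)
      = Gamma (real CARD('n) * \<kappa> + 1) / (\<kappa> * Gamma \<kappa> ^ CARD('n))"
    using \<kappa> Gamma_real_plus1[of "real CARD('n) * \<kappa>"] by (simp add: dirichlet_const_def)
  moreover have "(integrable M (\<lambda>y. f (y $ l)) \<longleftrightarrow>
        set_integrable (simplex_measure k) (open_simplex k) (simplex_integrand \<kappa> k l f x)) \<and>
      (\<integral>y. f (y $ l) \<partial>M) = simplex_formula \<kappa> k l f x"
    if M: "represents_at V x M" and f: "f \<in> borel_measurable borel" for f :: "real \<Rightarrow> real" and M
    using simplex_law_integral[OF \<kappa> f, of x k l]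
      integrable_distr_eq[OF represents_at_coord[OF M] f, of l]
      integral_distr[OF represents_at_coord[OF M] f, of l]
    unfolding distr_coord_eq_simplex_law[OF \<kappa> assms(2) M, of l k] by simp
  ultimately show "real CARD('n) * dirichlet_const \<kappa> CARD('n)
         = Gamma (real CARD('n) * \<kappa> + 1) / (\<kappa> * Gamma \<kappa> ^ CARD('n)) \<and>
       (\<forall>f :: real \<Rightarrow> real. real_polynomial_function f \<longrightarrow>
          set_integrable (simplex_measure k) (open_simplex k) (simplex_integrand \<kappa> k l f x) \<and>
          V (\<lambda>y. f (y $ l)) x = simplex_formula \<kappa> k l f x) \<and>
       (\<forall>(f :: real \<Rightarrow> real) M. represents_at V x M \<longrightarrow> f \<in> borel_measurable borel \<longrightarrow>
          (integrable M (\<lambda>y. f (y $ l)) \<longleftrightarrow>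
             set_integrable (simplex_measure k) (open_simplex k) (simplex_integrand \<kappa> k l f x)) \<and>
          (\<integral>y. f (y $ l) \<partial>M) = simplex_formula \<kappa> k l f x)"
    using intertwining_polynomial_eq_simplex_formula[OF \<kappa> assms(2)] by blast
next
  assume "\<kappa> = 0"
  with assms have V: "dunkl_intertwining 0 V" by simp
  have poly: "((\<lambda>\<epsilon>. simplex_formula \<epsilon> k l f x) \<longlongrightarrow> V (\<lambda>y. f (y $ l)) x) (at_right 0)"
    if f: "real_polynomial_function f" for f
  proof -
    have "continuous_on UNIV f"
      using f by (intro continuous_on_polymonial_function) (simp add: real_polynomial_function_eq)
    then show ?thesis
      unfolding intertwining_zero_polynomial[OF V f] by (rule simplex_formula_tendsto)
  qed
  have int: "integrable M (\<lambda>y. f (y $ l)) \<and> (\<integral>y. f (y $ l) \<partial>M) = f (x $ l)"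
    if "represents_at V x M" "f \<in> borel_measurable borel" for f :: "real \<Rightarrow> real" and M
    using represents_at_zero_integral[OF V that] by (simp add: has_bochner_integral_iff)
  have "((\<lambda>\<epsilon>. simplex_formula \<epsilon> k l f x) \<longlongrightarrow> (\<integral>y. f (y $ l) \<partial>M)) (at_right 0)"
    if "represents_at V x M" "continuous_on UNIV f" for f M
    using simplex_formula_tendsto[OF that(2), of k l x]
      int[OF that(1) borel_measurable_continuous_onI[OF that(2)]] by simp
  with poly int show "(\<forall>f :: real \<Rightarrow> real. real_polynomial_function f \<longrightarrow>
          ((\<lambda>\<epsilon>. simplex_formula \<epsilon> k l f x) \<longlongrightarrow> V (\<lambda>y. f (y $ l)) x) (at_right 0)) \<and>
       (\<forall>(f :: real \<Rightarrow> real) M. represents_at V x M \<longrightarrow> continuous_on UNIV f \<longrightarrow>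
          ((\<lambda>\<epsilon>. simplex_formula \<epsilon> k l f x) \<longlongrightarrow> (\<integral>y. f (y $ l) \<partial>M)) (at_right 0)) \<and>
       (\<forall>(f :: real \<Rightarrow> real) M. represents_at V x M \<longrightarrow> f \<in> borel_measurable borel \<longrightarrow>
          integrable M (\<lambda>y. f (y $ l)) \<and> (\<integral>y. f (y $ l) \<partial>M) = f (x $ l))"
    by blast
qed

end
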